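(* There exist absolute constants $c>0$ and $C>0$ such that the following holds. For every integer $n\ge 1$, every known reference distribution $q$ over $[n]$, and all parameters $0<\varepsilon_2\le 1$ and $0\le \varepsilon_1\le c\,\varepsilon_2$, there is a tester which, given \[ m \le C\left( n\Big(\frac{\varepsilon_1}{\varepsilon_2^2}\Big)^2+n\,\frac{\varepsilon_1}{\varepsilon_2^2}+\frac{\sqrt n}{\varepsilon_2^{2}} \right) \] independent samples from an unknown distribution $p$ over $[n]$ (and the full description of $q$), distinguishes between $\|p-q\|_1\le \varepsilon_1$ and $\|p-q\|_1\ge \varepsilon_2$ with probability at least $4/5$, i.e. it outputs "close" with probability $\ge 4/5$ whenever $\|p-q\|_1\le\varepsilon_1$ and outputs "far" with probability $\ge 4/5$ whenever $\|p-q\|_1\ge\varepsilon_2$.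
   Context: $[n]=\{1,\dots,n\}$. A distribution over $[n]$ is a nonnegative vector $(p_1,\dots,p_n)$ with $\sum_i p_i=1$, and $\|p-q\|_1=\sum_i|p_i-q_i|$. The tester may be randomized; the $4/5$ success probability is over its randomness and the samples. *)

theory Defs
  imports Complex_Main
begin

text \<open>A distribution over [n] = {1..n}: nonnegative weights on {1..n} summing to 1
  (values outside {1..n} are irrelevant).\<close>
definition is_dist :: "nat \<Rightarrow> (nat \<Rightarrow> real) \<Rightarrow> bool" where
  "is_dist n p \<longleftrightarrow> (\<forall>i\<in>{1..n}. 0 \<le> p i) \<and> (\<Sum>i=1..n. p i) = 1"

definition l1_dist :: "nat \<Rightarrow> (nat \<Rightarrow> real) \<Rightarrow> (nat \<Rightarrow> real) \<Rightarrow> real" where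
  "l1_dist n p q = (\<Sum>i=1..n. \<bar>p i - q i\<bar>)"

definition samples :: "nat \<Rightarrow> nat \<Rightarrow> nat list set" where
  "samples n m = {xs. length xs = m \<and> set xs \<subseteq> {1..n}}"

text \<open>A randomized tester with m samples is modelled by its acceptance function:
  T xs \<in> [0,1] is the probability (over the tester's internal randomness) that it
  outputs "close" on sample sequence xs.  The probability that it outputs "close"
  when the samples are i.i.d. from p:\<close>
definition accept_prob :: "nat \<Rightarrow> nat \<Rightarrow> (nat list \<Rightarrow> real) \<Rightarrow> (nat \<Rightarrow> real) \<Rightarrow> real" where
  "accept_prob n m T p = (\<Sum>xs\<in>samples n m. prod_list (map p xs) * T xs)"

end

theory Submission
  imports Defs "HOL-Analysis.Convex"
begin

text \<open>Let \<open>A\<close>, \<open>B\<close> be the count vectors of two batches of \<open>m\<close> samples from \<open>p\<close>, and \<open>C\<close>, \<open>C'\<close> those of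
  two simulated batches from \<open>q\<close>. The statistic
  \<open>Z = (\<Sum>i. \<Sum>k<m. (1[A\<^sub>i \<le> k] - 1[C\<^sub>i \<le> k]) (1[B\<^sub>i \<le> k] - 1[C'\<^sub>i \<le> k]))\<close> has as its mean the sum over \<open>i\<close> of
  the squared \<open>\<ell>\<^sub>2\<close> distance between the distribution functions of \<open>Bin(m, p\<^sub>i)\<close> and
  \<open>Bin(m, q\<^sub>i)\<close>.
  Since these distribution functions are ordered and differ by at most \<open>1\<close>, the mean is at most
  \<open>m \<parallel>p - q\<parallel>\<^sub>1\<close>. Since their difference has total mass \<open>\<delta>\<^sub>i = m \<bar>p\<^sub>i - q\<^sub>i\<bar>\<close>, half of it in a window of width
  \<open>O(1 + \<delta>\<^sub>i + \<surd>(m q\<^sub>i))\<close>, Cauchy--Schwarz bounds the mean below by a constant times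
  \<open>(m \<epsilon>\<^sub>2)\<^sup>2 / (n + m \<epsilon>\<^sub>2 + \<surd>(m n))\<close> in the far case. The three terms of the denominator require
  \<open>m \<ge> C n \<epsilon>\<^sub>1 / \<epsilon>\<^sub>2\<^sup>2\<close>, \<open>\<epsilon>\<^sub>1 \<le> c \<epsilon>\<^sub>2\<close> and \<open>m \<ge> C n (\<epsilon>\<^sub>1 / \<epsilon>\<^sub>2\<^sup>2)\<^sup>2\<close> for the far mean to exceed the close
  one. The Efron--Stein inequality, applied to the fixed-size samples without Poissonization, bounds
  the variance, after splitting heavy elements of \<open>q\<close>, by \<open>O(min m (m\<^sup>2 / n))\<close> plus a multiple of
  the mean; Chebyshev's inequality then needs \<open>m \<ge> C \<surd>n / \<epsilon>\<^sub>2\<^sup>2\<close>.\<close>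

section \<open>Expectations over independent samples\<close>

definition prob_vec :: "'a set \<Rightarrow> ('a \<Rightarrow> real) \<Rightarrow> bool" where
  "prob_vec S w \<longleftrightarrow> (\<forall>x\<in>S. 0 \<le> w x) \<and> sum w S = 1"

lemma prob_vec_finite: "prob_vec S w \<Longrightarrow> finite S"
  by (metis prob_vec_def sum.infinite zero_neq_one)

text \<open>One weight function per coordinate lets genuine and simulated samples share a product
  space. Normalisation is assumed, through \<open>prob_vec\<close>, only where it matters.\<close>

fun expect :: "'a set \<Rightarrow> ('a \<Rightarrow> real) list \<Rightarrow> ('a list \<Rightarrow> real) \<Rightarrow> real" where
  "expect S [] f = f []"
| "expect S (w # ws) f = (\<Sum>x\<in>S. w x * expect S ws (\<lambda>xs. f (x # xs)))"

lemma expect_cong: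
  assumes "\<And>xs. length xs = length ws \<Longrightarrow> set xs \<subseteq> S \<Longrightarrow> f xs = g xs"
  shows "expect S ws f = expect S ws g"
  using assms
proof (induction ws arbitrary: f g)
  case (Cons w ws)
  have "expect S ws (\<lambda>xs. f (x # xs)) = expect S ws (\<lambda>xs. g (x # xs))" if "x \<in> S" for x
    by (rule Cons.IH) (use Cons.prems that in auto)
  then show ?case by simp
qed simp

lemma expect_add: "expect S ws (\<lambda>xs. f xs + g xs) = expect S ws f + expect S ws g"
  by (induction ws arbitrary: f g) (simp_all add: distrib_left sum.distrib)

lemma expect_cmult: "expect S ws (\<lambda>xs. c * f xs) = c * expect S ws f"
  by (induction ws arbitrary: f) (simp_all add: sum_distrib_left mult.left_commute)

lemma expect_diff: "expect S ws (\<lambda>xs. f xs - g xs) = expect S ws f - expect S ws g"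
  using expect_add[of S ws f "\<lambda>xs. (-1) * g xs"] expect_cmult[of S ws "-1" g] by simp

lemma expect_zero: "expect S ws (\<lambda>xs. 0) = 0"
  using expect_cmult[of S ws 0 "\<lambda>_. 0"] by simp

lemma expect_sum: "expect S ws (\<lambda>xs. \<Sum>i\<in>I. f i xs) = (\<Sum>i\<in>I. expect S ws (f i))"
  by (induction I rule: infinite_finite_induct) (simp_all add: expect_add expect_zero)

lemma expect_mult_right: "expect S ws (\<lambda>xs. f xs * c) = expect S ws f * c"
  using expect_cmult[of S ws c f] by (simp add: mult.commute)

lemma expect_const:
  assumes "\<forall>w\<in>set ws. prob_vec S w"
  shows "expect S ws (\<lambda>_. c) = c"
  using assms by (induction ws) (auto simp: prob_vec_def simp flip: sum_distrib_right)

lemma expect_mono: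
  assumes "\<forall>w\<in>set ws. prob_vec S w" "\<And>xs. f xs \<le> g xs"
  shows "expect S ws f \<le> expect S ws g"
  using assms
  by (induction ws arbitrary: f g) (auto simp: prob_vec_def intro!: sum_mono mult_left_mono)

lemma expect_append:
  "expect S (us @ vs) f = expect S us (\<lambda>xs. expect S vs (\<lambda>ys. f (xs @ ys)))"
  by (induction us arbitrary: f) simp_all

lemma expect_swap:
  "expect A us (\<lambda>x. expect B vs (\<lambda>y. f x y)) = expect B vs (\<lambda>y. expect A us (\<lambda>x. f x y))"
  by (induction us arbitrary: f) (simp_all add: expect_sum expect_cmult)

lemma abs_expect_le:
  assumes "\<forall>w\<in>set ws. prob_vec S w" "\<And>xs. \<bar>f xs\<bar> \<le> g xs"
  shows "\<bar>expect S ws f\<bar> \<le> expect S ws g"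
proof -
  have "expect S ws f \<le> expect S ws g"
    using assms by (intro expect_mono) (auto simp: abs_le_iff)
  moreover have "expect S ws (\<lambda>xs. (-1) * f xs) \<le> expect S ws g"
    using assms by (intro expect_mono) (auto simp: abs_le_iff)
  ultimately show ?thesis unfolding expect_cmult by simp
qed

text \<open>Drawing \<open>x\<close> from \<open>p\<close> and then \<open>y\<close> from
  \<open>K x\<close> amounts to drawing \<open>y\<close> from the mixture, coordinate by coordinate.
  The tail \<open>vs\<close> makes room for simulated samples.\<close>

lemma expect_channel:
  "expect A (replicate k p) (\<lambda>xs. expect B (map K xs @ vs) f)
    = expect B (replicate k (\<lambda>y. \<Sum>x\<in>A. p x * K x y) @ vs) f"
proof (induction k arbitrary: f)
  case (Suc k)
  have "expect A (replicate (Suc k) p) (\<lambda>xs. expect B (map K xs @ vs) f)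
     = (\<Sum>x\<in>A. p x * (\<Sum>y\<in>B. K x y * expect A (replicate k p)
          (\<lambda>xs. expect B (map K xs @ vs) (\<lambda>ys. f (y # ys)))))"
    by (simp add: expect_sum expect_cmult)
  also have "\<dots> = (\<Sum>x\<in>A. \<Sum>y\<in>B. p x * K x y *
      expect B (replicate k (\<lambda>y. \<Sum>x\<in>A. p x * K x y) @ vs) (\<lambda>ys. f (y # ys)))"
    by (simp add: Suc.IH sum_distrib_left mult.assoc)
  also have "\<dots> = (\<Sum>y\<in>B. (\<Sum>x\<in>A. p x * K x y) *
      expect B (replicate k (\<lambda>y. \<Sum>x\<in>A. p x * K x y) @ vs) (\<lambda>ys. f (y # ys)))"
    by (subst sum.swap) (simp add: sum_distrib_right)
  finally show ?case by simp
qed simp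

text \<open>Peeling off the first sample turns the sum over sample lists into the recursion that
  defines \<open>expect\<close>.\<close>

lemma accept_prob_eq_expect: "accept_prob n m T p = expect {1..n} (replicate m p) T"
proof (induction m arbitrary: T)
  case 0
  have "samples n 0 = {[]}" by (auto simp: samples_def)
  then show ?case by (simp add: accept_prob_def)
next
  case (Suc m)
  have img: "samples n (Suc m) = (\<lambda>(x, xs). x # xs) ` ({1..n} \<times> samples n m)"
    by (force simp: samples_def image_iff length_Suc_conv)
  have inj: "inj_on (\<lambda>(x, xs). x # xs) ({1..n} \<times> samples n m)"
    by (auto simp: inj_on_def)
  have "accept_prob n (Suc m) T p
      = (\<Sum>(x, xs)\<in>{1..n} \<times> samples n m. p x * (prod_list (map p xs) * T (x # xs)))"
    unfolding accept_prob_def img by (subst sum.reindex[OF inj]) (auto intro!: sum.cong)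
  also have "\<dots> = (\<Sum>x=1..n. p x * accept_prob n m (\<lambda>xs. T (x # xs)) p)"
    unfolding accept_prob_def by (simp add: sum.cartesian_product sum_distrib_left)
  finally show ?case by (simp add: Suc.IH)
qed

text \<open>Efron--Stein: the variance in the first coordinate is at most the second moment about any
  quantity that does not depend on that coordinate; here, the mean with the coordinate deleted.\<close>
lemma variance_le_sum_increments:
  assumes "\<forall>w\<in>set ws. prob_vec S w"
    and "\<And>xs x ys. x \<in> S \<Longrightarrow> \<bar>f (xs @ x # ys) - f (xs @ ys)\<bar> \<le> h x"
  shows "expect S ws (\<lambda>xs. (f xs)\<^sup>2) - (expect S ws f)\<^sup>2 \<le> (\<Sum>w\<leftarrow>ws. \<Sum>x\<in>S. w x * (h x)\<^sup>2)"
  using assms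
proof (induction ws arbitrary: f)
  case (Cons w ws)
  define M where "M x = expect S ws (\<lambda>xs. f (x # xs))" for x
  define g where "g = expect S ws f"
  define V where "V = (\<Sum>w\<leftarrow>ws. \<Sum>x\<in>S. w x * (h x)\<^sup>2)"
  have ws: "\<forall>w\<in>set ws. prob_vec S w" and w0: "\<And>x. x \<in> S \<Longrightarrow> 0 \<le> w x" and w1: "sum w S = 1"
    using Cons.prems(1) by (auto simp: prob_vec_def)
  have inner: "expect S ws (\<lambda>xs. (f (x # xs))\<^sup>2) \<le> (M x)\<^sup>2 + V" if "x \<in> S" for x
  proof -
    have "\<bar>f (x # xs @ y # ys) - f (x # xs @ ys)\<bar> \<le> h y" if "y \<in> S" for xs y ys
      using Cons.prems(2)[of y "x # xs" ys] that by simp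
    then show ?thesis
      using Cons.IH[of "\<lambda>xs. f (x # xs)"] ws by (simp add: M_def V_def)
  qed
  have outer: "(M x - g)\<^sup>2 \<le> (h x)\<^sup>2" if "x \<in> S" for x
  proof -
    have "\<bar>expect S ws (\<lambda>xs. f (x # xs) - f xs)\<bar> \<le> expect S ws (\<lambda>_. h x)"
      using Cons.prems(2)[of x "[]"] that by (intro abs_expect_le[OF ws]) simp
    then have "\<bar>M x - g\<bar> \<le> h x"
      by (simp add: expect_diff expect_const[OF ws] M_def g_def)
    then show ?thesis by (metis abs_ge_zero power2_abs power_mono)
  qed
  have "expect S (w # ws) (\<lambda>xs. (f xs)\<^sup>2) \<le> (\<Sum>x\<in>S. w x * ((M x)\<^sup>2 + V))"
    using inner w0 by (auto intro!: sum_mono mult_left_mono)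
  also have "\<dots> = (\<Sum>x\<in>S. w x * (M x)\<^sup>2) + V"
    by (simp add: distrib_left sum.distrib w1 flip: sum_distrib_right)
  finally have up: "expect S (w # ws) (\<lambda>xs. (f xs)\<^sup>2) \<le> (\<Sum>x\<in>S. w x * (M x)\<^sup>2) + V" .
  define \<mu> where "\<mu> = (\<Sum>x\<in>S. w x * M x)"
  have "(\<Sum>x\<in>S. w x * (M x - g)\<^sup>2) = (\<Sum>x\<in>S. w x * (M x)\<^sup>2 - 2 * g * (w x * M x) + g\<^sup>2 * w x)"
    by (rule sum.cong) (simp_all add: power2_eq_square algebra_simps)
  also have "\<dots> = (\<Sum>x\<in>S. w x * (M x)\<^sup>2) - 2 * g * \<mu> + g\<^sup>2"
    by (simp add: sum.distrib sum_subtractf \<mu>_def w1 flip: sum_distrib_left)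
  finally have "(\<Sum>x\<in>S. w x * (M x)\<^sup>2) - \<mu>\<^sup>2 = (\<Sum>x\<in>S. w x * (M x - g)\<^sup>2) - (\<mu> - g)\<^sup>2"
    by (simp add: power2_eq_square algebra_simps)
  also have "\<dots> \<le> (\<Sum>x\<in>S. w x * (M x - g)\<^sup>2)" by simp
  also have "\<dots> \<le> (\<Sum>x\<in>S. w x * (h x)\<^sup>2)"
    using outer w0 by (auto intro!: sum_mono mult_left_mono)
  finally have "(\<Sum>x\<in>S. w x * (M x)\<^sup>2) - \<mu>\<^sup>2 \<le> (\<Sum>x\<in>S. w x * (h x)\<^sup>2)" .
  moreover have "expect S (w # ws) f = \<mu>" by (simp add: M_def \<mu>_def)
  ultimately show ?case using up by (simp add: V_def)
qed simp

section \<open>Sums of independent Bernoulli variables\<close>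

text \<open>\<open>bsum ss f\<close> is the mean of \<open>f\<close> at a sum of independent Bernoulli variables with success
  probabilities \<open>ss\<close>.\<close>
fun bsum :: "real list \<Rightarrow> (nat \<Rightarrow> real) \<Rightarrow> real" where
  "bsum [] f = f 0"
| "bsum (s # ss) f = s * bsum ss (\<lambda>k. f (Suc k)) + (1 - s) * bsum ss f"

text \<open>Only whether each draw equals \<open>x\<close> matters, so the count is a sum of
  independent Bernoulli variables.\<close>

lemma expect_count:
  assumes "\<forall>w\<in>set ws. prob_vec S w" "x \<in> S"
  shows "expect S ws (\<lambda>xs. f (count_list xs x)) = bsum (map (\<lambda>w. w x) ws) f"
  using assms
proof (induction ws arbitrary: f)
  case (Cons w ws)
  have w1: "sum w S = 1" and fin: "finite S"
    using Cons.prems prob_vec_finite[of S w] by (auto simp: prob_vec_def)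
  let ?B = "bsum (map (\<lambda>w. w x) ws)"
  have "expect S ws (\<lambda>xs. f (count_list (y # xs) x))
      = (if y = x then ?B (\<lambda>k. f (Suc k)) else ?B f)" for y
    using Cons.IH[of "\<lambda>k. f (Suc k)"] Cons.IH[of f] Cons.prems by auto
  then have "expect S (w # ws) (\<lambda>xs. f (count_list xs x))
      = (\<Sum>y\<in>S. w y * (if y = x then ?B (\<lambda>k. f (Suc k)) else ?B f))"
    by simp
  also have "\<dots> = w x * ?B (\<lambda>k. f (Suc k)) + (\<Sum>y\<in>S - {x}. w y) * ?B f"
    using fin Cons.prems(2) by (subst sum.remove[of _ x]) (auto simp: sum_distrib_right)
  also have "(\<Sum>y\<in>S - {x}. w y) = 1 - w x"
    using fin Cons.prems(2) w1 by (simp add: sum_diff1)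
  finally show ?case by simp
qed simp

lemma bsum_cong:
  assumes "\<And>k. k \<le> length ss \<Longrightarrow> f k = g k"
  shows "bsum ss f = bsum ss g"
  using assms
proof (induction ss arbitrary: f g)
  case (Cons s ss)
  have "bsum ss f = bsum ss g" "bsum ss (\<lambda>k. f (Suc k)) = bsum ss (\<lambda>k. g (Suc k))"
    using Cons.prems by (auto intro!: Cons.IH)
  then show ?case by simp
qed simp

lemma bsum_add: "bsum ss (\<lambda>k. f k + g k) = bsum ss f + bsum ss g"
  by (induction ss arbitrary: f g) (simp_all add: algebra_simps)

lemma bsum_cmult: "bsum ss (\<lambda>k. c * f k) = c * bsum ss f"
  by (induction ss arbitrary: f) (simp_all add: algebra_simps)

lemma bsum_const: "bsum ss (\<lambda>k. c) = c"
  by (induction ss) (simp_all add: algebra_simps)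

lemma bsum_sum: "bsum ss (\<lambda>k. \<Sum>i\<in>I. f i k) = (\<Sum>i\<in>I. bsum ss (f i))"
  by (induction I rule: infinite_finite_induct) (simp_all add: bsum_add bsum_const)

lemma bsum_mono:
  assumes "\<forall>s\<in>set ss. 0 \<le> s \<and> s \<le> 1" "\<And>k. f k \<le> g k"
  shows "bsum ss f \<le> bsum ss g"
  using assms by (induction ss arbitrary: f g) (auto intro!: add_mono mult_left_mono)

lemma bsum_mean: "bsum ss real = sum_list ss"
proof (induction ss)
  case (Cons s ss)
  have "bsum ss (\<lambda>k. real (Suc k)) = 1 + bsum ss real"
    using bsum_add[of ss "\<lambda>_. 1" real] by (simp add: bsum_const)
  then show ?case using Cons by (simp add: algebra_simps)
qed simp

text \<open>Squared bias plus variance. The centre is arbitrary for the sake of the induction: a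
  success at the head shifts it to \<open>c - 1\<close>.\<close>

lemma bsum_second_moment:
  "bsum ss (\<lambda>k. (real k - c)\<^sup>2) = (sum_list ss - c)\<^sup>2 + (\<Sum>s\<leftarrow>ss. s * (1 - s))"
proof (induction ss arbitrary: c)
  case (Cons s ss)
  have "bsum ss (\<lambda>k. (real (Suc k) - c)\<^sup>2) = bsum ss (\<lambda>k. (real k - (c - 1))\<^sup>2)"
    by (simp add: algebra_simps)
  then have "bsum (s # ss) (\<lambda>k. (real k - c)\<^sup>2)
      = s * ((sum_list ss - (c - 1))\<^sup>2 + (\<Sum>s\<leftarrow>ss. s * (1 - s)))
        + (1 - s) * ((sum_list ss - c)\<^sup>2 + (\<Sum>s\<leftarrow>ss. s * (1 - s)))"
    by (simp only: bsum.simps Cons.IH)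
  then show ?case by (simp add: power2_eq_square algebra_simps)
qed simp

text \<open>Addition commutes; this brings the parameter to be replaced to the front.\<close>

lemma bsum_move: "bsum (ss @ s # us) f = bsum (s # ss @ us) f"
proof (induction ss arbitrary: f)
  case (Cons a ss)
  have "bsum ((a # ss) @ s # us) f
      = a * bsum (s # ss @ us) (\<lambda>k. f (Suc k)) + (1 - a) * bsum (s # ss @ us) f"
    by (simp only: append_Cons bsum.simps(2)[of a] Cons.IH)
  then show ?case by (simp add: algebra_simps)
qed simp

lemma bsum_zeros_left: "bsum (replicate k 0 @ ss) f = bsum ss f"
  by (induction k) simp_all

lemma bsum_zeros_right: "bsum (ss @ replicate k 0) f = bsum ss f"
  using bsum_zeros_left[of k "[]"] by (induction ss arbitrary: f) simp_all

text \<open>Lindeberg replacement: the Bernoulli parameters are changed one at a time.\<close>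
lemma bsum_replicate_diff:
  "bsum (replicate m t) f - bsum (replicate m s) f
    = (t - s) * (\<Sum>j<m. bsum (replicate j t @ replicate (m - 1 - j) s) (\<lambda>k. f (Suc k) - f k))"
proof -
  define a where "a j = bsum (replicate j t @ replicate (m - j) s) f" for j
  have step: "a (Suc j) - a j
      = (t - s) * bsum (replicate j t @ replicate (m - 1 - j) s) (\<lambda>k. f (Suc k) - f k)"
    if "j < m" for j
  proof -
    let ?r = "replicate j t @ replicate (m - 1 - j) s"
    have "a (Suc j) = bsum (t # ?r) f" by (simp add: a_def)
    moreover have "m - j = Suc (m - 1 - j)" using that by simp
    then have "a j = bsum (s # ?r) f"
      using bsum_move[of "replicate j t" s "replicate (m - 1 - j) s" f] by (simp add: a_def)
    moreover have "bsum ?r (\<lambda>k. f (Suc k) - f k) = bsum ?r (\<lambda>k. f (Suc k)) - bsum ?r f"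
      using bsum_add[of ?r "\<lambda>k. f (Suc k)" "\<lambda>k. (-1) * f k"] bsum_cmult[of ?r "-1" f] by simp
    ultimately show ?thesis by (simp only: bsum.simps) (simp add: left_diff_distrib right_diff_distrib)
  qed
  have "bsum (replicate m t) f - bsum (replicate m s) f = a m - a 0" by (simp add: a_def)
  also have "\<dots> = (\<Sum>j<m. a (Suc j) - a j)" by (simp add: sum_lessThan_telescope)
  finally show ?thesis by (simp add: step sum_distrib_left)
qed

text \<open>The squared \<open>\<ell>\<^sub>2\<close> distance of the distribution functions of Bin(m, s) and Bin(m, t).\<close>
definition energy :: "nat \<Rightarrow> real \<Rightarrow> real \<Rightarrow> real" where
  "energy m s t = (\<Sum>k<m. (bsum (replicate m s) (\<lambda>x. of_bool (x \<le> k))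
                           - bsum (replicate m t) (\<lambda>x. of_bool (x \<le> k)))\<^sup>2)"

lemma energy_commute: "energy m s t = energy m t s"
  unfolding energy_def by (simp add: power2_commute)

lemma energy_nonneg: "0 \<le> energy m s t"
  unfolding energy_def by (simp add: sum_nonneg)

text \<open>The differences \<open>d\<close> of the two distribution functions are \<open>t - s\<close> times the sum of the
  probability mass functions of the hybrid sums that interpolate between the binomials.\<close>
lemma energy_profile:
  assumes st: "0 \<le> s" "s \<le> t" "t \<le> 1"
  obtains d :: "nat \<Rightarrow> real" where "\<And>k. 0 \<le> d k" "\<And>k. d k \<le> 1"
    "energy m s t = (\<Sum>k<m. (d k)\<^sup>2)"
    "\<And>g. (\<Sum>k<m. d k * g k)
       = (t - s) * (\<Sum>j<m. bsum (replicate j t @ replicate (m - 1 - j) s) g)"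
proof
  let ?F = "\<lambda>s k. bsum (replicate m s) (\<lambda>x. of_bool (x \<le> k))"
  let ?h = "\<lambda>j. replicate j t @ replicate (m - 1 - j) s"
  define d where "d k = ?F s k - ?F t k" for k
  show "energy m s t = (\<Sum>k<m. (d k)\<^sup>2)" by (simp add: energy_def d_def)
  have d: "d k = (t - s) * (\<Sum>j<m. bsum (?h j) (\<lambda>x. of_bool (x = k)))" for k
  proof -
    have "(\<lambda>x. of_bool (Suc x \<le> k) - of_bool (x \<le> k)) = (\<lambda>x. (-1) * of_bool (x = k) :: real)"
      by (auto simp: fun_eq_iff)
    then have "?F t k - ?F s k = (t - s) * (\<Sum>j<m. bsum (?h j) (\<lambda>x. (-1) * of_bool (x = k)))"
      using bsum_replicate_diff[of m t "\<lambda>x. of_bool (x \<le> k)" s] by simp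
    then show ?thesis by (simp only: bsum_cmult d_def) (simp add: sum_negf)
  qed
  have "0 \<le> bsum (?h j) (\<lambda>x. of_bool (x = k))" for j k
  proof -
    have "\<forall>s\<in>set (?h j). 0 \<le> s \<and> s \<le> 1" using st by auto
    from bsum_mono[OF this, of "\<lambda>_. 0" "\<lambda>x. of_bool (x = k)"] show ?thesis by (simp add: bsum_const)
  qed
  then show "0 \<le> d k" for k unfolding d using st by (intro mult_nonneg_nonneg sum_nonneg) auto
  have "?F s k \<le> 1" "0 \<le> ?F t k" for k
    using st bsum_mono[of "replicate m s" "\<lambda>x. of_bool (x \<le> k)" "\<lambda>_. 1"]
      bsum_mono[of "replicate m t" "\<lambda>_. 0" "\<lambda>x. of_bool (x \<le> k)"]
    by (simp_all add: bsum_const)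
  then show "d k \<le> 1" for k by (smt (verit) d_def)
  show "(\<Sum>k<m. d k * g k) = (t - s) * (\<Sum>j<m. bsum (?h j) g)" for g
  proof -
    have "(\<Sum>k<m. d k * g k) = (t - s) * (\<Sum>k<m. \<Sum>j<m. g k * bsum (?h j) (\<lambda>x. of_bool (x = k)))"
      unfolding d by (simp add: sum_distrib_left sum_distrib_right mult_ac)
    also have "\<dots> = (t - s) * (\<Sum>j<m. bsum (?h j) (\<lambda>x. \<Sum>k<m. g k * of_bool (x = k)))"
      by (subst sum.swap) (simp only: bsum_sum bsum_cmult)
    also have "(\<Sum>j<m. bsum (?h j) (\<lambda>x. \<Sum>k<m. g k * of_bool (x = k))) = (\<Sum>j<m. bsum (?h j) g)"
    proof (rule sum.cong[OF refl], rule bsum_cong)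
      fix j x assume "j \<in> {..<m}" "x \<le> length (?h j)"
      \<comment> \<open>A hybrid has only \<open>m - 1\<close> summands, so its value is below
        \<open>m\<close> and the range \<open>k < m\<close> misses nothing.\<close>
      then have "x < m" by auto
      then have "(\<Sum>k<m. g k * of_bool (x = k)) = (\<Sum>k\<in>{x}. g k * of_bool (x = k))"
        by (intro sum.mono_neutral_right) auto
      then show "(\<Sum>k<m. g k * of_bool (x = k)) = g x" by simp
    qed
    finally show ?thesis .
  qed
qed

section \<open>Upper and lower bounds on the energy\<close>

text \<open>The profile \<open>d\<close> lies in \<open>[0,1]\<close>, so its squares sum to at most
  its total mass, which is \<open>m\<close> times the parameter gap.\<close>

lemma energy_le:
  assumes "0 \<le> s" "s \<le> 1" "0 \<le> t" "t \<le> 1"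
  shows "energy m s t \<le> real m * \<bar>s - t\<bar>"
proof -
  have *: "energy m s t \<le> real m * (t - s)" if st: "0 \<le> s" "s \<le> t" "t \<le> 1" for s t
  proof -
    obtain d where d: "\<And>k. 0 \<le> d k" "\<And>k. d k \<le> 1" "energy m s t = (\<Sum>k<m. (d k)\<^sup>2)"
      "\<And>g. (\<Sum>k<m. d k * g k) = (t - s) * (\<Sum>j<m. bsum (replicate j t @ replicate (m - 1 - j) s) g)"
      using energy_profile[OF st] by blast
    have "(\<Sum>k<m. (d k)\<^sup>2) \<le> (\<Sum>k<m. d k * 1)"
      using d(1,2) by (intro sum_mono) (simp add: power2_eq_square mult_left_le)
    also have "\<dots> = real m * (t - s)" unfolding d(4) by (simp add: bsum_const)
    finally show ?thesis using d(3) by simp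
  qed
  show ?thesis
    using *[of s t] *[of t s] assms energy_commute[of m s t] by (cases "s \<le> t") auto
qed

lemma card_nat_window:
  fixes c R :: real
  assumes "0 \<le> R"
  shows "real (card {k. k < m \<and> \<bar>real k - c\<bar> \<le> R}) \<le> 2 * R + 1"
proof -
  let ?W = "{k. k < m \<and> \<bar>real k - c\<bar> \<le> R}"
  have "int ` ?W \<subseteq> {\<lceil>c - R\<rceil>..\<lfloor>c + R\<rfloor>}"
    by (auto simp: ceiling_le_iff le_floor_iff abs_le_iff)
  then have "card (int ` ?W) \<le> card {\<lceil>c - R\<rceil>..\<lfloor>c + R\<rfloor>}" by (intro card_mono) auto
  then have "card ?W \<le> nat (\<lfloor>c + R\<rfloor> - \<lceil>c - R\<rceil> + 1)"
    by (simp add: card_image)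
  moreover have "real_of_int (\<lfloor>c + R\<rfloor> - \<lceil>c - R\<rceil> + 1) \<le> 2 * R + 1"
    using of_int_floor_le[of "c + R"] le_of_int_ceiling[of "c - R"] by (simp; linarith)
  ultimately show ?thesis using assms by linarith
qed

text \<open>By Markov's inequality at least half of the mass of \<open>d\<close> lies within
  \<open>sqrt (2 * V)\<close> of \<open>c\<close>. Cauchy--Schwarz on that window, which holds at
  most \<open>2 * sqrt (2 * V) + 1\<close> integers, gives the bound.\<close>

lemma sum_squares_ge_concentrated:
  fixes d :: "nat \<Rightarrow> real"
  assumes d: "\<And>k. 0 \<le> d k" and V: "0 < V"
    and mom: "(\<Sum>k<m. d k * (real k - c)\<^sup>2) \<le> (\<Sum>k<m. d k) * V"
  shows "(\<Sum>k<m. d k)\<^sup>2 \<le> 4 * (2 * sqrt (2 * V) + 1) * (\<Sum>k<m. (d k)\<^sup>2)"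
proof -
  define R where "R = sqrt (2 * V)"
  define W where "W = {k. k < m \<and> \<bar>real k - c\<bar> \<le> R}"
  define w where "w = (\<Sum>k<m. d k)"
  have R: "0 < R" "R\<^sup>2 = 2 * V" using V by (auto simp: R_def)
  have W: "W \<subseteq> {..<m}" by (auto simp: W_def)
  have w0: "0 \<le> w" using d by (simp add: w_def sum_nonneg)
  have "2 * V * (\<Sum>k\<in>{..<m} - W. d k) \<le> (\<Sum>k\<in>{..<m} - W. d k * (real k - c)\<^sup>2)"
    unfolding sum_distrib_left
  proof (rule sum_mono)
    fix k assume "k \<in> {..<m} - W"
    then have "R \<le> \<bar>real k - c\<bar>" by (auto simp: W_def)
    then have "R\<^sup>2 \<le> (real k - c)\<^sup>2" using R by (metis abs_le_square_iff abs_of_pos)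
    then show "2 * V * d k \<le> d k * (real k - c)\<^sup>2" using R d[of k] by (simp add: mult_left_mono mult.commute)
  qed
  also have "\<dots> \<le> (\<Sum>k<m. d k * (real k - c)\<^sup>2)"
    using d by (intro sum_mono2) auto
  also have "\<dots> \<le> w * V" using mom by (simp add: w_def)
  finally have "V * (2 * (\<Sum>k\<in>{..<m} - W. d k)) \<le> V * w" by (simp add: mult_ac)
  then have "2 * (\<Sum>k\<in>{..<m} - W. d k) \<le> w" using V by simp
  moreover have "w = (\<Sum>k\<in>{..<m} - W. d k) + (\<Sum>k\<in>W. d k)"
    unfolding w_def using W by (simp add: sum.subset_diff)
  ultimately have "w \<le> 2 * (\<Sum>k\<in>W. d k)" by simp
  then have "w\<^sup>2 \<le> (2 * (\<Sum>k\<in>W. d k))\<^sup>2" using w0 by (intro power_mono)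
  also have "\<dots> = 4 * (\<Sum>k\<in>W. d k)\<^sup>2" by (simp add: power_mult_distrib)
  also have "(\<Sum>k\<in>W. d k)\<^sup>2 \<le> real (card W) * (\<Sum>k\<in>W. (d k)\<^sup>2)"
    using sum_squared_le_sum_of_squares[of d W] by (simp add: mult.commute)
  also have "\<dots> \<le> (2 * R + 1) * (\<Sum>k<m. (d k)\<^sup>2)"
    using card_nat_window[of R m c] R W
    by (intro mult_mono sum_mono2) (auto simp: W_def sum_nonneg)
  finally show ?thesis by (simp only: w_def R_def mult.assoc)
qed

lemma sum_list_replicate_bounds:
  assumes "0 \<le> s" "s \<le> t" "j < m"
  shows "real (m - 1) * s \<le> sum_list (replicate j t @ replicate (m - 1 - j) s)"
    and "sum_list (replicate j t @ replicate (m - 1 - j) s) \<le> real (m - 1) * s + real m * (t - s)"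
proof -
  have "sum_list (replicate j t @ replicate (m - 1 - j) s)
      = real (m - 1) * s + real j * (t - s)"
    using assms(3) by (simp add: sum_list_replicate of_nat_diff algebra_simps)
  moreover have "0 \<le> real j * (t - s)" "real j * (t - s) \<le> real m * (t - s)"
    using assms by (auto intro: mult_right_mono)
  ultimately show "real (m - 1) * s \<le> sum_list (replicate j t @ replicate (m - 1 - j) s)"
    "sum_list (replicate j t @ replicate (m - 1 - j) s) \<le> real (m - 1) * s + real m * (t - s)"
    by simp_all
qed

lemma energy_ge_ordered:
  fixes m :: nat and s t :: real
  assumes st: "0 \<le> s" "s \<le> t" "t \<le> 1"
  defines "\<delta> \<equiv> real m * (t - s)"
  shows "\<delta>\<^sup>2 \<le> 16 * (1 + \<delta> + sqrt (real m * s)) * energy m s t"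
proof (cases "\<delta> = 0")
  case True
  then show ?thesis using energy_nonneg[of m s t] st by simp
next
  case False
  moreover have "0 \<le> \<delta>" using st by (simp add: \<delta>_def)
  ultimately have \<delta>: "0 < \<delta>" by linarith
  let ?h = "\<lambda>j. replicate j t @ replicate (m - 1 - j) s"
  obtain d where d: "\<And>k. 0 \<le> d k" "\<And>k. d k \<le> 1" "energy m s t = (\<Sum>k<m. (d k)\<^sup>2)"
    "\<And>g. (\<Sum>k<m. d k * g k) = (t - s) * (\<Sum>j<m. bsum (?h j) g)"
    using energy_profile[OF st] by blast
  have tot: "(\<Sum>k<m. d k) = \<delta>" using d(4)[of "\<lambda>_. 1"] by (simp add: bsum_const \<delta>_def)
  define c where "c = real (m - 1) * s"
  \<comment> \<open>Each hybrid mean is within \<open>\<delta>\<close> of \<open>c\<close>, which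
    gives \<open>\<delta>\<^sup>2\<close>; each hybrid variance is at most its mean, hence at most
    \<open>real m * s + \<delta>\<close>.\<close>
  define V where "V = real m * s + \<delta> + \<delta>\<^sup>2"
  have V: "0 < V" using \<delta> st by (simp add: V_def add_nonneg_pos)
  have "bsum (?h j) (\<lambda>k. (real k - c)\<^sup>2) \<le> V" if "j < m" for j
  proof -
    have "(sum_list (?h j) - c)\<^sup>2 \<le> \<delta>\<^sup>2"
      using sum_list_replicate_bounds[OF st(1,2) that] \<delta>
      by (intro power_mono) (auto simp: c_def \<delta>_def)
    moreover have "(\<Sum>s\<leftarrow>?h j. s * (1 - s)) \<le> (\<Sum>s\<leftarrow>?h j. s)"
      using st by (intro sum_list_mono) (auto simp: mult_left_le)
    moreover have "real (m - 1) * s \<le> real m * s" using st by (intro mult_right_mono) auto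
    ultimately show ?thesis
      using sum_list_replicate_bounds(2)[OF st(1,2) that]
      unfolding bsum_second_moment V_def \<delta>_def by simp
  qed
  then have "(\<Sum>j<m. bsum (?h j) (\<lambda>k. (real k - c)\<^sup>2)) \<le> (\<Sum>j<m. V)" by (intro sum_mono) auto
  then have "(\<Sum>k<m. d k * (real k - c)\<^sup>2) \<le> (t - s) * (real m * V)"
    unfolding d(4) using st by (intro mult_left_mono) auto
  then have mom: "(\<Sum>k<m. d k * (real k - c)\<^sup>2) \<le> (\<Sum>k<m. d k) * V"
    unfolding tot by (simp add: \<delta>_def mult_ac)
  define x where "x = 1 + \<delta> + sqrt (real m * s)"
  have x: "1 \<le> x" using \<delta> st by (simp add: x_def)
  have "V \<le> x\<^sup>2"
  proof -
    have "x\<^sup>2 = (1 + \<delta>)\<^sup>2 + 2 * (1 + \<delta>) * sqrt (real m * s) + real m * s"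
      using st by (simp add: x_def power2_sum)
    moreover have "0 \<le> 2 * (1 + \<delta>) * sqrt (real m * s)" using \<delta> st by simp
    moreover have "(1 + \<delta>)\<^sup>2 = 1 + 2 * \<delta> + \<delta>\<^sup>2" by (simp add: power2_eq_square algebra_simps)
    ultimately show ?thesis using \<delta> by (simp add: V_def)
  qed
  then have "2 * V \<le> 2 * x\<^sup>2" by simp
  \<comment> \<open>The value \<open>3/2\<close> is a rational upper bound for
    \<open>sqrt 2\<close>; with \<open>1 \<le> x\<close> it yields
    \<open>4 * (3 * x + 1) \<le> 16 * x\<close>.\<close>
  also have "\<dots> \<le> (3/2 * x)\<^sup>2" by (simp add: power_mult_distrib power_divide)
  finally have "2 * V \<le> (3/2 * x)\<^sup>2" .
  then have "sqrt (2 * V) \<le> 3/2 * x" using x by (intro real_le_lsqrt) auto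
  then have "4 * (2 * sqrt (2 * V) + 1) \<le> 16 * x" using x by simp
  then have "4 * (2 * sqrt (2 * V) + 1) * (\<Sum>k<m. (d k)\<^sup>2) \<le> 16 * x * (\<Sum>k<m. (d k)\<^sup>2)"
    by (intro mult_right_mono) (auto simp: sum_nonneg)
  then show ?thesis
    using sum_squares_ge_concentrated[OF d(1) V mom] unfolding tot d(3) x_def by linarith
qed

text \<open>Either order reduces to the ordered case. The root keeps only \<open>t\<close>, later
  the reference parameter, so that it can be summed without knowledge of \<open>p\<close>.\<close>

lemma energy_ge:
  fixes m :: nat and s t :: real
  assumes "0 \<le> s" "s \<le> 1" "0 \<le> t" "t \<le> 1"
  defines "\<delta> \<equiv> real m * \<bar>s - t\<bar>"
  shows "\<delta>\<^sup>2 \<le> 16 * (1 + \<delta> + sqrt (real m * t)) * energy m s t"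
proof (cases "s \<le> t")
  case True
  then have "\<delta>\<^sup>2 \<le> 16 * (1 + \<delta> + sqrt (real m * s)) * energy m s t"
    using energy_ge_ordered[of s t m] assms by simp
  also have "\<dots> \<le> 16 * (1 + \<delta> + sqrt (real m * t)) * energy m s t"
    using True energy_nonneg by (intro mult_right_mono) (auto simp: mult_left_mono)
  finally show ?thesis .
next
  case False
  then show ?thesis
    using energy_ge_ordered[of t s m] assms by (simp add: energy_commute[of m s t])
qed

section \<open>The test statistic\<close>

text \<open>The tester pools genuine samples, tagged \<open>True\<close>, with simulated samples from the reference
  distribution, tagged \<open>False\<close>.\<close>
definition tag :: "bool \<Rightarrow> ('a \<Rightarrow> real) \<Rightarrow> 'a \<times> bool \<Rightarrow> real" where
  "tag b w x = (if snd x = b then w (fst x) else 0)"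

definition tagged :: "nat \<Rightarrow> ('a \<Rightarrow> real) \<Rightarrow> ('a \<Rightarrow> real) \<Rightarrow> ('a \<times> bool \<Rightarrow> real) list" where
  "tagged m p q = replicate m (tag True p) @ replicate m (tag False q)"

definition cdf_gap :: "('a \<times> bool) list \<Rightarrow> 'a \<Rightarrow> nat \<Rightarrow> real" where
  "cdf_gap e i k = of_bool (count_list e (i, True) \<le> k) - of_bool (count_list e (i, False) \<le> k)"

text \<open>The indicator that \<open>i\<close> was seen in the pool; written with
  \<open>min\<close>, it yields both bounds on its mean by monotonicity.\<close>

definition occupied :: "('a \<times> bool) list \<Rightarrow> 'a \<Rightarrow> real" where
  "occupied e i = min 1 (real (count_list e (i, True)) + real (count_list e (i, False)))"

text \<open>Multiplying gaps of two independent pools, instead of squaring one gap, makes the mean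
  exactly a sum of squared differences, with no bias from the variance.\<close>

definition stat :: "'a set \<Rightarrow> nat \<Rightarrow> ('a \<times> bool) list \<Rightarrow> ('a \<times> bool) list \<Rightarrow> real" where
  "stat D m e e' = (\<Sum>i\<in>D. \<Sum>k<m. cdf_gap e i k * cdf_gap e' i k)"

lemma sum_tag: "(\<Sum>x\<in>D \<times> UNIV. tag b w x * g (fst x)) = (\<Sum>i\<in>D. w i * g i)"
proof -
  have "(\<Sum>x\<in>D \<times> UNIV. tag b w x * g (fst x)) = (\<Sum>i\<in>D. \<Sum>c\<in>UNIV. tag b w (i, c) * g i)"
    by (simp add: sum.cartesian_product case_prod_beta)
  also have "\<dots> = (\<Sum>i\<in>D. w i * g i)"
    by (rule sum.cong) (auto simp: tag_def UNIV_bool)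
  finally show ?thesis .
qed

lemma prob_vec_tag: "prob_vec D w \<Longrightarrow> prob_vec (D \<times> UNIV) (tag b w)"
  using sum_tag[where D=D and b=b and w=w and g="\<lambda>_. 1"] by (auto simp: prob_vec_def tag_def)

lemma prob_vec_tagged:
  "prob_vec D p \<Longrightarrow> prob_vec D q \<Longrightarrow> \<forall>w\<in>set (tagged m p q). prob_vec (D \<times> UNIV) w"
  by (auto simp: tagged_def prob_vec_tag)

lemma sum_tagged:
  "(\<Sum>w\<leftarrow>tagged m p q. \<Sum>x\<in>D \<times> UNIV. w x * g (fst x)) = real m * (\<Sum>i\<in>D. (p i + q i) * g i)"
  by (simp add: tagged_def sum_list_replicate sum_tag distrib_right sum.distrib distrib_left)

text \<open>Samples carrying the other tag have success probability \<open>0\<close> and drop out of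
  the sum.\<close>

lemma expect_count_tagged:
  assumes "prob_vec D p" "prob_vec D q" "i \<in> D"
  shows "expect (D \<times> UNIV) (tagged m p q) (\<lambda>e. f (count_list e (i, True))) = bsum (replicate m (p i)) f"
    and "expect (D \<times> UNIV) (tagged m p q) (\<lambda>e. f (count_list e (i, False))) = bsum (replicate m (q i)) f"
  using assms
  by (subst expect_count[OF prob_vec_tagged];
      simp add: tagged_def tag_def bsum_zeros_left bsum_zeros_right)+

lemma expect_cdf_gap:
  assumes "prob_vec D p" "prob_vec D q" "i \<in> D"
  shows "expect (D \<times> UNIV) (tagged m p q) (\<lambda>e. cdf_gap e i k)
    = bsum (replicate m (p i)) (\<lambda>x. of_bool (x \<le> k)) - bsum (replicate m (q i)) (\<lambda>x. of_bool (x \<le> k))"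
  unfolding cdf_gap_def expect_diff
  using expect_count_tagged[OF assms, where f="\<lambda>x. of_bool (x \<le> k)"] by simp

text \<open>At an unseen element both counts are \<open>0\<close>, so both indicators are
  \<open>1\<close> and cancel.\<close>

lemma abs_cdf_gap_le: "\<bar>cdf_gap e i k\<bar> \<le> occupied e i"
  by (auto simp: cdf_gap_def occupied_def min_def)

lemma expect_occupied_le:
  assumes "prob_vec D p" "prob_vec D q" "i \<in> D"
  shows "expect (D \<times> UNIV) (tagged m p q) (\<lambda>e. occupied e i) \<le> min 1 (real m * (p i + q i))"
proof -
  note w = prob_vec_tagged[OF assms(1,2), of m]
  have "expect (D \<times> UNIV) (tagged m p q) (\<lambda>e. occupied e i)
      \<le> expect (D \<times> UNIV) (tagged m p q) (\<lambda>_. 1)"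
    by (intro expect_mono[OF w]) (simp add: occupied_def)
  moreover have "expect (D \<times> UNIV) (tagged m p q) (\<lambda>e. occupied e i)
      \<le> expect (D \<times> UNIV) (tagged m p q)
          (\<lambda>e. real (count_list e (i, True)) + real (count_list e (i, False)))"
    by (intro expect_mono[OF w]) (simp add: occupied_def)
  moreover have "\<dots> = real m * (p i + q i)"
    unfolding expect_add using expect_count_tagged[OF assms, where f=real]
    by (simp add: bsum_mean sum_list_replicate distrib_left)
  ultimately show ?thesis by (simp add: expect_const[OF w])
qed

text \<open>Raising a count from \<open>c\<close> to \<open>c + 1\<close> changes its indicator only
  at \<open>k = c\<close>.\<close>

lemma cdf_gap_insert:
  "cdf_gap (xs @ x # ys) i k - cdf_gap (xs @ ys) i k
    = (if i = fst x \<and> k = count_list (xs @ ys) x then (if snd x then -1 else 1) else 0)"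
  by (cases x) (auto simp: cdf_gap_def)

text \<open>One more sample changes a single indicator of the distribution functions, so the increment is
  one value of \<open>H\<close>.\<close>
lemma cdf_gap_pairing_increment:
  assumes "finite D" "x \<in> D \<times> UNIV" and H: "\<And>i k. i \<in> D \<Longrightarrow> \<bar>H i k\<bar> \<le> h i"
  shows "\<bar>(\<Sum>i\<in>D. \<Sum>k<m. cdf_gap (xs @ x # ys) i k * H i k)
        - (\<Sum>i\<in>D. \<Sum>k<m. cdf_gap (xs @ ys) i k * H i k)\<bar> \<le> h (fst x)"
proof -
  let ?c = "count_list (xs @ ys) x" and ?s = "if snd x then -1 else 1 :: real"
  have x: "fst x \<in> D" using assms(2) by auto
  have "(\<Sum>i\<in>D. \<Sum>k<m. cdf_gap (xs @ x # ys) i k * H i k)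
        - (\<Sum>i\<in>D. \<Sum>k<m. cdf_gap (xs @ ys) i k * H i k)
      = (\<Sum>i\<in>D. \<Sum>k<m. (cdf_gap (xs @ x # ys) i k - cdf_gap (xs @ ys) i k) * H i k)"
    by (simp add: sum_subtractf left_diff_distrib)
  also have "\<dots> = (\<Sum>i\<in>D. if i = fst x then (\<Sum>k<m. (if k = ?c then ?s else 0) * H (fst x) k) else 0)"
    unfolding cdf_gap_insert by (intro sum.cong refl) auto
  also have "\<dots> = (\<Sum>k<m. (if k = ?c then ?s else 0) * H (fst x) k)"
    using assms(1) x by simp
  also have "\<dots> = (\<Sum>k<m. if k = ?c then ?s * H (fst x) k else 0)"
    by (intro sum.cong refl) auto
  also have "\<dots> = (if ?c < m then ?s * H (fst x) ?c else 0)"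
    by simp
  finally show ?thesis using H[OF x, of ?c] by (auto simp: abs_mult)
qed

lemma square_le_self: "0 \<le> x \<Longrightarrow> x \<le> 1 \<Longrightarrow> x\<^sup>2 \<le> x" for x :: real
  by (simp add: power2_eq_square mult_left_le)

section \<open>Mean, variance and concentration of the statistic\<close>

lemma expect_stat:
  assumes pq: "prob_vec D p" "prob_vec D q"
  shows "expect (D \<times> UNIV) (tagged m p q) (\<lambda>e'. expect (D \<times> UNIV) (tagged m p q) (\<lambda>e. stat D m e e'))
    = (\<Sum>i\<in>D. energy m (p i) (q i))"
proof -
  let ?E = "expect (D \<times> UNIV) (tagged m p q)"
  have "?E (\<lambda>e'. ?E (\<lambda>e. stat D m e e'))
      = (\<Sum>i\<in>D. \<Sum>k<m. (?E (\<lambda>e. cdf_gap e i k))\<^sup>2)"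
    by (simp add: stat_def expect_sum expect_mult_right expect_cmult power2_eq_square)
  also have "\<dots> = (\<Sum>i\<in>D. energy m (p i) (q i))"
    by (intro sum.cong refl) (simp add: energy_def expect_cdf_gap[OF pq])
  finally show ?thesis .
qed

text \<open>The statistic is bilinear in two independent pools. Its variance is the mean conditional variance
  given one pool plus the variance of the conditional mean; Efron--Stein applies to both. The
  factor \<open>occupied\<close>, at most \<open>1\<close> and \<open>0\<close> at unseen elements, is what makes the variance
  quadratic instead of linear in the counts at rare elements.\<close>
lemma expect_stat_square_le:
  assumes pq: "prob_vec D p" "prob_vec D q"
  shows "expect (D \<times> UNIV) (tagged m p q)
      (\<lambda>e'. expect (D \<times> UNIV) (tagged m p q) (\<lambda>e. (stat D m e e')\<^sup>2))
    \<le> (\<Sum>i\<in>D. energy m (p i) (q i))\<^sup>2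
      + 2 * (\<Sum>i\<in>D. real m * (p i + q i) * min 1 (real m * (p i + q i)))"
proof -
  let ?E = "expect (D \<times> UNIV) (tagged m p q)"
  note w = prob_vec_tagged[OF pq, of m]
  have fin: "finite D" using pq(1) by (rule prob_vec_finite)
  have pq0: "0 \<le> p i + q i" if "i \<in> D" for i using pq that by (auto simp: prob_vec_def)
  define N where "N i k = ?E (\<lambda>e. cdf_gap e i k)" for i k
  define \<kappa> where "\<kappa> i = min 1 (real m * (p i + q i))" for i
  define L where "L e' = (\<Sum>i\<in>D. \<Sum>k<m. cdf_gap e' i k * N i k)" for e'
  have occ: "0 \<le> occupied e i" "occupied e i \<le> 1" for e :: "('a \<times> bool) list" and i
    by (auto simp: occupied_def)
  \<comment> \<open>With \<open>e'\<close> fixed, a new sample in \<open>e\<close> moves the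
    statistic by at most the occupancy of its element in \<open>e'\<close>; \<open>L e'\<close> is
    the conditional mean.\<close>
  have inner: "?E (\<lambda>e. (stat D m e e')\<^sup>2)
      \<le> (L e')\<^sup>2 + real m * (\<Sum>i\<in>D. (p i + q i) * occupied e' i)" for e'
  proof -
    have "?E (\<lambda>e. (stat D m e e')\<^sup>2) - (?E (\<lambda>e. stat D m e e'))\<^sup>2
        \<le> (\<Sum>w\<leftarrow>tagged m p q. \<Sum>x\<in>D \<times> UNIV. w x * (occupied e' (fst x))\<^sup>2)"
      unfolding stat_def
      by (intro variance_le_sum_increments[OF w] cdf_gap_pairing_increment fin abs_cdf_gap_le)
    also have "\<dots> \<le> real m * (\<Sum>i\<in>D. (p i + q i) * occupied e' i)"
      unfolding sum_tagged[where g="\<lambda>i. (occupied e' i)\<^sup>2"] using pq0 occ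
      by (intro mult_left_mono sum_mono square_le_self) auto
    finally show ?thesis
      by (simp add: stat_def L_def N_def expect_sum expect_mult_right mult.commute)
  qed
  have N: "\<bar>N i k\<bar> \<le> \<kappa> i" if "i \<in> D" for i k
    using abs_expect_le[OF w, of "\<lambda>e. cdf_gap e i k" "\<lambda>e. occupied e i", OF abs_cdf_gap_le] expect_occupied_le[OF pq that, of m]
    by (simp add: N_def \<kappa>_def)
  have \<kappa>: "0 \<le> \<kappa> i" "\<kappa> i \<le> 1" if "i \<in> D" for i using pq0[OF that] by (auto simp: \<kappa>_def)
  have "?E L = (\<Sum>i\<in>D. energy m (p i) (q i))"
    unfolding L_def expect_sum expect_mult_right N_def energy_def power2_eq_square
    by (intro sum.cong refl) (simp add: expect_cdf_gap[OF pq])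
  \<comment> \<open>The conditional mean \<open>L\<close> is again a pairing, now against the mean
    gaps \<open>N\<close>, which \<open>\<kappa>\<close> bounds.\<close>
  moreover have "?E (\<lambda>e'. (L e')\<^sup>2) - (?E L)\<^sup>2
      \<le> (\<Sum>w\<leftarrow>tagged m p q. \<Sum>x\<in>D \<times> UNIV. w x * (\<kappa> (fst x))\<^sup>2)"
    unfolding L_def by (intro variance_le_sum_increments[OF w] cdf_gap_pairing_increment fin N)
  moreover have "\<dots> \<le> real m * (\<Sum>i\<in>D. (p i + q i) * \<kappa> i)"
    unfolding sum_tagged[where g="\<lambda>i. (\<kappa> i)\<^sup>2"] using pq0 \<kappa>
    by (intro mult_left_mono sum_mono square_le_self) auto
  ultimately have outer: "?E (\<lambda>e'. (L e')\<^sup>2)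
      \<le> (\<Sum>i\<in>D. energy m (p i) (q i))\<^sup>2 + real m * (\<Sum>i\<in>D. (p i + q i) * \<kappa> i)"
    by simp
  have "?E (\<lambda>e'. ?E (\<lambda>e. (stat D m e e')\<^sup>2))
      \<le> ?E (\<lambda>e'. (L e')\<^sup>2 + real m * (\<Sum>i\<in>D. (p i + q i) * occupied e' i))"
    by (intro expect_mono[OF w] inner)
  also have "\<dots> = ?E (\<lambda>e'. (L e')\<^sup>2) + real m * (\<Sum>i\<in>D. (p i + q i) * ?E (\<lambda>e'. occupied e' i))"
    by (simp add: expect_add expect_cmult expect_sum)
  also have "\<dots> \<le> ?E (\<lambda>e'. (L e')\<^sup>2) + real m * (\<Sum>i\<in>D. (p i + q i) * \<kappa> i)"
    using expect_occupied_le[OF pq, of _ m] pq0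
    by (intro add_left_mono mult_left_mono sum_mono) (auto simp: \<kappa>_def)
  finally have "?E (\<lambda>e'. ?E (\<lambda>e. (stat D m e e')\<^sup>2))
      \<le> ?E (\<lambda>e'. (L e')\<^sup>2) + real m * (\<Sum>i\<in>D. (p i + q i) * \<kappa> i)" .
  moreover have "real m * (\<Sum>i\<in>D. (p i + q i) * \<kappa> i)
      = (\<Sum>i\<in>D. real m * (p i + q i) * min 1 (real m * (p i + q i)))"
    by (simp add: \<kappa>_def sum_distrib_left mult.assoc)
  ultimately show ?thesis using outer by linarith
qed

text \<open>Pointwise, \<open>(\<tau> - \<mu>)\<^sup>2 * B\<close> is at most the squared deviation
  of \<open>Z\<close>, whose mean is at most \<open>V\<close>. \<open>B\<close> is the 0/1 indicator
  of the error event, so one lemma serves both outcomes.\<close>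

lemma chebyshev_expect2:
  fixes Z :: "'a list \<Rightarrow> 'a list \<Rightarrow> real"
  assumes w: "\<forall>w\<in>set ws. prob_vec S w"
    and mean: "expect S ws (\<lambda>e'. expect S ws (\<lambda>e. Z e e')) = \<mu>"
    and second: "expect S ws (\<lambda>e'. expect S ws (\<lambda>e. (Z e e')\<^sup>2)) \<le> \<mu>\<^sup>2 + V"
    and "\<tau> \<noteq> \<mu>" and B: "\<And>e e'. B e e' = 1 \<or> B e e' = 0"
    and far: "\<And>e e'. B e e' = 1 \<Longrightarrow> \<bar>\<tau> - \<mu>\<bar> \<le> \<bar>Z e e' - \<mu>\<bar>"
  shows "expect S ws (\<lambda>e'. expect S ws (\<lambda>e. B e e')) \<le> V / (\<tau> - \<mu>)\<^sup>2"
proof -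
  have t: "0 < (\<tau> - \<mu>)\<^sup>2" using assms(4) by simp
  have "(\<tau> - \<mu>)\<^sup>2 * B e e' \<le> (Z e e')\<^sup>2 - 2 * \<mu> * Z e e' + \<mu>\<^sup>2" for e e'
  proof -
    have "(\<tau> - \<mu>)\<^sup>2 * B e e' \<le> (Z e e' - \<mu>)\<^sup>2"
      using B[of e e'] far[of e e'] by (auto simp: abs_le_square_iff)
    then show ?thesis by (simp add: power2_diff algebra_simps)
  qed
  then have "expect S ws (\<lambda>e'. expect S ws (\<lambda>e. (\<tau> - \<mu>)\<^sup>2 * B e e'))
    \<le> expect S ws (\<lambda>e'. expect S ws (\<lambda>e. (Z e e')\<^sup>2 - 2 * \<mu> * Z e e' + \<mu>\<^sup>2))"
    by (intro expect_mono[OF w])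
  also have "\<dots> \<le> V"
    using mean second
    by (simp add: expect_add expect_diff expect_cmult expect_const[OF w] power2_eq_square)
  finally show ?thesis unfolding expect_cmult using t by (simp add: pos_le_divide_eq mult.commute)
qed

section \<open>Signal and noise\<close>

lemma min_one_mult_scale:
  fixes x y :: real
  assumes "0 \<le> x" "x \<le> 3 * y"
  shows "x * min 1 x \<le> 9 * (y * min 1 y)"
proof -
  have "x * min 1 x \<le> (3 * y) * (3 * min 1 y)"
    using assms by (intro mult_mono) auto
  then show ?thesis by simp
qed

text \<open>If \<open>s\<close> is at most about \<open>2t\<close>, the variance is controlled by \<open>t\<close> alone; otherwise
  \<open>s - t\<close> is comparable to \<open>s + t\<close> and the energy pays for it.\<close>
lemma variance_term_le:
  assumes "0 \<le> s" "s \<le> 1" "0 \<le> t" "t \<le> 1"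
  shows "real m * (s + t) * min 1 (real m * (s + t))
    \<le> 9 * (real m * t * min 1 (real m * t)) + 576 * energy m s t"
proof -
  define \<delta> where "\<delta> = real m * \<bar>s - t\<bar>"
  define E where "E = energy m s t"
  define y where "y = real m * t"
  have E: "0 \<le> E" by (simp add: E_def energy_nonneg)
  have y: "0 \<le> y" using assms by (simp add: y_def)
  have \<delta>: "0 \<le> \<delta>" by (simp add: \<delta>_def)
  have "real m * (s - t) \<le> \<delta>" unfolding \<delta>_def by (intro mult_left_mono) auto
  then have lam: "0 \<le> real m * (s + t)" "real m * (s + t) \<le> 2 * y + \<delta>"
    using assms by (auto simp: y_def algebra_simps)
  show ?thesis
  \<comment> \<open>By \<open>lam\<close>, the total is at most three times the larger of
    \<open>y\<close> and \<open>\<delta>\<close>, as \<open>min_one_mult_scale\<close> requires. In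
    the second case \<open>sqrt y \<le> 1 + \<delta>\<close>, which leads to
    \<open>576 = 9 * 64\<close>.\<close>
  proof (cases "\<delta> \<le> y")
    case True
    then have "real m * (s + t) * min 1 (real m * (s + t)) \<le> 9 * (y * min 1 y)"
      using lam by (intro min_one_mult_scale) auto
    then show ?thesis using E by (simp add: y_def E_def)
  next
    case False
    then have 1: "real m * (s + t) * min 1 (real m * (s + t)) \<le> 9 * (\<delta> * min 1 \<delta>)"
      using lam by (intro min_one_mult_scale) auto
    have "sqrt y \<le> 1 + y"
      using y by (intro real_le_lsqrt) (auto simp: power2_eq_square algebra_simps)
    then have "16 * (1 + \<delta> + sqrt y) * E \<le> 16 * (2 * (1 + \<delta>)) * E"
      using False E by (intro mult_right_mono) auto
    then have 2: "\<delta>\<^sup>2 \<le> (1 + \<delta>) * (32 * E)"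
      using energy_ge[OF assms, of m] by (simp add: \<delta>_def y_def E_def algebra_simps)
    have "(1 + \<delta>) * (\<delta> * min 1 \<delta>) \<le> 2 * \<delta>\<^sup>2"
    proof -
      have "(1 + \<delta>) * min 1 \<delta> \<le> 2 * \<delta>" using \<delta> by (auto simp: min_def mult_left_le algebra_simps)
      then have "\<delta> * ((1 + \<delta>) * min 1 \<delta>) \<le> \<delta> * (2 * \<delta>)" using \<delta> by (intro mult_left_mono)
      then show ?thesis by (simp add: power2_eq_square mult_ac)
    qed
    then have "(1 + \<delta>) * (\<delta> * min 1 \<delta>) \<le> (1 + \<delta>) * (64 * E)" using 2 by simp
    then have "\<delta> * min 1 \<delta> \<le> 64 * E" using \<delta> by simp
    then have "real m * (s + t) * min 1 (real m * (s + t)) \<le> 9 * (64 * E)"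
      by (intro order_trans[OF 1]) simp
    also have "\<dots> \<le> 9 * (y * min 1 y) + 576 * E" using y by simp
    finally show ?thesis by (simp only: y_def E_def)
  qed
qed

lemma prob_vec_bounds:
  assumes "prob_vec D p" "i \<in> D"
  shows "0 \<le> p i" "p i \<le> 1"
proof -
  have "finite D" using assms(1) by (rule prob_vec_finite)
  then have "p i \<le> sum p D" using assms by (intro member_le_sum) (auto simp: prob_vec_def)
  then show "0 \<le> p i" "p i \<le> 1" using assms by (simp_all add: prob_vec_def)
qed

text \<open>Take roots in \<open>energy_ge\<close>, sum over the domain, and separate weights from
  energies by Cauchy--Schwarz.\<close>

lemma sum_energy_ge:
  assumes pq: "prob_vec D p" "prob_vec D q" and card: "card D \<le> 2 * n"
  defines "L \<equiv> (\<Sum>i\<in>D. \<bar>p i - q i\<bar>)"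
  shows "(real m * L)\<^sup>2
    \<le> 32 * (real n + real m * L + sqrt (real m * real n)) * (\<Sum>i\<in>D. energy m (p i) (q i))"
proof -
  define w where "w i = 1 + real m * \<bar>p i - q i\<bar> + sqrt (real m * q i)" for i
  define E where "E i = energy m (p i) (q i)" for i
  have q0: "0 \<le> q i" if "i \<in> D" for i using pq that by (auto simp: prob_vec_def)
  have w0: "0 \<le> w i" if "i \<in> D" for i using q0[OF that] by (simp add: w_def)
  have E0: "0 \<le> E i" for i by (simp add: E_def energy_nonneg)
  have "real m * \<bar>p i - q i\<bar> \<le> 4 * (sqrt (w i) * sqrt (E i))" if i: "i \<in> D" for i
  proof -
    have "(real m * \<bar>p i - q i\<bar>)\<^sup>2 \<le> 16 * w i * E i"
      unfolding w_def E_def by (intro energy_ge prob_vec_bounds[OF pq(1) i] prob_vec_bounds[OF pq(2) i])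
    also have "\<dots> = (4 * (sqrt (w i) * sqrt (E i)))\<^sup>2"
      using w0[OF i] E0 by (simp add: power_mult_distrib)
    finally show ?thesis by (rule power2_le_imp_le) (use w0[OF i] E0 in simp)
  qed
  then have "real m * L \<le> 4 * (\<Sum>i\<in>D. sqrt (w i) * sqrt (E i))"
    unfolding L_def sum_distrib_left by (intro sum_mono) auto
  then have "(real m * L)\<^sup>2 \<le> (4 * (\<Sum>i\<in>D. sqrt (w i) * sqrt (E i)))\<^sup>2"
    by (intro power_mono) (auto simp: L_def sum_nonneg)
  also have "\<dots> = 16 * (\<Sum>i\<in>D. sqrt (w i) * sqrt (E i))\<^sup>2" by (simp add: power_mult_distrib)
  also have "\<dots> \<le> 16 * ((\<Sum>i\<in>D. (sqrt (w i))\<^sup>2) * (\<Sum>i\<in>D. (sqrt (E i))\<^sup>2))"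
    by (intro mult_left_mono Cauchy_Schwarz_ineq_sum) auto
  also have "\<dots> = 16 * (\<Sum>i\<in>D. w i) * (\<Sum>i\<in>D. E i)" using w0 E0 by simp
  also have "\<dots> \<le> 16 * (2 * (real n + real m * L + sqrt (real m * real n))) * (\<Sum>i\<in>D. E i)"
  proof (intro mult_right_mono mult_left_mono)
    \<comment> \<open>A second Cauchy--Schwarz uses that \<open>q\<close> sums to one. The count
      \<open>2 * n\<close> is relaxed to \<open>4 * n\<close> to give a clean square.\<close>
    have "(\<Sum>i\<in>D. sqrt (real m * q i))\<^sup>2 \<le> (\<Sum>i\<in>D. (sqrt (real m * q i))\<^sup>2) * real (card D)"
      by (rule sum_squared_le_sum_of_squares)
    also have "(\<Sum>i\<in>D. (sqrt (real m * q i))\<^sup>2) = real m"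
      using q0 pq(2) by (simp add: prob_vec_def flip: sum_distrib_left)
    also have "real m * real (card D) \<le> real m * (4 * real n)"
      using card by (intro mult_left_mono) auto
    also have "\<dots> = (2 * sqrt (real m * real n))\<^sup>2" by (simp add: power_mult_distrib)
    finally have "(\<Sum>i\<in>D. sqrt (real m * q i)) \<le> 2 * sqrt (real m * real n)"
      by (rule power2_le_imp_le) simp
    moreover have "real (card D) \<le> 2 * real n" using card by simp
    moreover have "(\<Sum>i\<in>D. w i) = real (card D) + real m * L + (\<Sum>i\<in>D. sqrt (real m * q i))"
      by (simp add: w_def L_def sum.distrib sum_distrib_left)
    moreover have "0 \<le> real m * L" by (simp add: L_def sum_nonneg)
    ultimately show "(\<Sum>i\<in>D. w i) \<le> 2 * (real n + real m * L + sqrt (real m * real n))"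
      unfolding distrib_left by linarith
  qed (auto simp: sum_nonneg E0)
  finally show ?thesis by (simp only: E_def mult.assoc[symmetric])
qed

section \<open>Thresholds and the required sample size\<close>

text \<open>The bound of \<open>sum_energy_ge\<close> solved for the energy at distance
  \<open>\<epsilon>\<close>; half of it is the acceptance threshold.\<close>

definition signal :: "nat \<Rightarrow> nat \<Rightarrow> real \<Rightarrow> real" where
  "signal n m \<epsilon> = (real m * \<epsilon>)\<^sup>2 / (32 * (real n + real m * \<epsilon> + sqrt (real m * real n)))"

text \<open>The bound increases with the true distance \<open>L\<close>, so it persists at
  \<open>\<epsilon>\<close>; weighting the two sides by \<open>L\<close> and
  \<open>\<epsilon>\<close> lets \<open>L\<close> cancel at the end.\<close>

lemma signal_le_sum_energy:
  assumes pq: "prob_vec D p" "prob_vec D q" and card: "card D \<le> 2 * n"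
    and n: "1 \<le> n" and \<epsilon>: "0 < \<epsilon>" "\<epsilon> \<le> (\<Sum>i\<in>D. \<bar>p i - q i\<bar>)"
  shows "signal n m \<epsilon> \<le> (\<Sum>i\<in>D. energy m (p i) (q i))"
proof -
  define L where "L = (\<Sum>i\<in>D. \<bar>p i - q i\<bar>)"
  define \<mu> where "\<mu> = (\<Sum>i\<in>D. energy m (p i) (q i))"
  define r where "r = real n + sqrt (real m * real n)"
  have L: "0 < L" "\<epsilon> \<le> L" using \<epsilon> by (auto simp: L_def)
  have r: "0 < r" using n by (simp add: r_def add_pos_nonneg)
  have \<mu>: "0 \<le> \<mu>" by (simp add: \<mu>_def sum_nonneg energy_nonneg)
  have "L * (real m * \<epsilon>)\<^sup>2 \<le> \<epsilon> * (real m * L)\<^sup>2"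
    using L \<epsilon> by (simp add: power_mult_distrib power2_eq_square mult_ac mult_right_mono)
  also have "\<dots> \<le> \<epsilon> * (32 * (r + real m * L) * \<mu>)"
    using sum_energy_ge[OF pq card, of m] \<epsilon>(1)
    by (intro mult_left_mono) (auto simp: L_def \<mu>_def r_def algebra_simps)
  also have "\<dots> = 32 * (\<epsilon> * r + L * (real m * \<epsilon>)) * \<mu>" by (simp add: algebra_simps)
  also have "\<dots> \<le> 32 * (L * r + L * (real m * \<epsilon>)) * \<mu>"
    using L r \<mu> by (intro mult_right_mono mult_left_mono add_right_mono) auto
  also have "\<dots> = L * (\<mu> * (32 * (r + real m * \<epsilon>)))" by (simp add: algebra_simps)
  finally have "(real m * \<epsilon>)\<^sup>2 \<le> \<mu> * (32 * (r + real m * \<epsilon>))" using L by simp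
  moreover have "0 < 32 * (r + real m * \<epsilon>)" using r \<epsilon> by (simp add: add_pos_nonneg)
  ultimately have "(real m * \<epsilon>)\<^sup>2 / (32 * (r + real m * \<epsilon>)) \<le> \<mu>" by (simp add: pos_divide_le_eq)
  then show ?thesis by (simp add: signal_def \<mu>_def r_def algebra_simps)
qed

text \<open>The mean is at most a quarter of the signal in the close case and at least the signal in
  the far case. Chebyshev's inequality separates them at one half.\<close>

lemma signal_test:
  fixes D :: "'a set" and p q :: "'a \<Rightarrow> real" and m n :: nat and \<epsilon>\<^sub>1 \<epsilon>\<^sub>2 :: real
  assumes pq: "prob_vec D p" "prob_vec D q" and card: "card D \<le> 2 * n"
    and n: "1 \<le> n" and \<epsilon>: "0 < \<epsilon>\<^sub>2" and flat: "\<And>i. i \<in> D \<Longrightarrow> q i \<le> 1 / real n"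
    and S1: "46080 \<le> signal n m \<epsilon>\<^sub>2"
    and S2: "2880 * (real m * min 1 (real m / real n)) \<le> (signal n m \<epsilon>\<^sub>2)\<^sup>2"
    and S3: "4 * (real m * \<epsilon>\<^sub>1) \<le> signal n m \<epsilon>\<^sub>2"
  defines "A \<equiv> expect (D \<times> UNIV) (tagged m p q) (\<lambda>e'. expect (D \<times> UNIV) (tagged m p q)
      (\<lambda>e. of_bool (stat D m e e' \<le> signal n m \<epsilon>\<^sub>2 / 2)))"
  shows "(\<Sum>i\<in>D. \<bar>p i - q i\<bar>) \<le> \<epsilon>\<^sub>1 \<Longrightarrow> 4/5 \<le> A"
    and "\<epsilon>\<^sub>2 \<le> (\<Sum>i\<in>D. \<bar>p i - q i\<bar>) \<Longrightarrow> A \<le> 1/5"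
proof -
  define S where "S = signal n m \<epsilon>\<^sub>2"
  define \<mu> where "\<mu> = (\<Sum>i\<in>D. energy m (p i) (q i))"
  define V where "V = 2 * (\<Sum>i\<in>D. real m * (p i + q i) * min 1 (real m * (p i + q i)))"
  let ?E = "expect (D \<times> UNIV) (tagged m p q)"
  note w = prob_vec_tagged[OF pq, of m]
  note mean = expect_stat[OF pq, of m, folded \<mu>_def]
  note second = expect_stat_square_le[OF pq, of m, folded \<mu>_def V_def]
  have b: "0 \<le> p i" "p i \<le> 1" "0 \<le> q i" "q i \<le> 1" if "i \<in> D" for i
    using prob_vec_bounds[OF pq(1) that] prob_vec_bounds[OF pq(2) that] by auto
  have "V \<le> 2 * (\<Sum>i\<in>D. 9 * (real m * min 1 (real m / real n)) * q i + 576 * energy m (p i) (q i))"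
    unfolding V_def
  proof (intro mult_left_mono sum_mono)
    fix i assume i: "i \<in> D"
    have "real m * q i \<le> real m * (1 / real n)" using flat[OF i] by (intro mult_left_mono) auto
    then have "real m * q i * min 1 (real m * q i) \<le> real m * q i * min 1 (real m / real n)"
      using b[OF i] by (intro mult_left_mono) auto
    then show "real m * (p i + q i) * min 1 (real m * (p i + q i))
        \<le> 9 * (real m * min 1 (real m / real n)) * q i + 576 * energy m (p i) (q i)"
      using variance_term_le[OF b[OF i], of m] by (simp add: mult_ac)
  qed simp
  also have "\<dots> = 18 * (real m * min 1 (real m / real n)) + 1152 * \<mu>"
    using pq(2) by (simp add: sum.distrib \<mu>_def prob_vec_def flip: sum_distrib_left)
  \<comment> \<open>Here \<open>2880 = 18 * 160\<close>. As \<open>46080 = 40 * 1152\<close>, the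
    linear term is at most \<open>S\<^sup>2 / 160\<close> in the close case, for a total of
    \<open>S\<^sup>2 / 80\<close>, one fifth of \<open>(S / 4)\<^sup>2\<close>. In the far case it
    is at most \<open>\<mu>\<^sup>2 / 40\<close>.\<close>
  finally have V: "V \<le> S\<^sup>2 / 160 + 1152 * \<mu>" using S2 by (simp add: S_def)
  have S: "46080 \<le> S" using S1 by (simp add: S_def)
  show "4/5 \<le> A" if close: "(\<Sum>i\<in>D. \<bar>p i - q i\<bar>) \<le> \<epsilon>\<^sub>1"
  proof -
    have "\<mu> \<le> (\<Sum>i\<in>D. real m * \<bar>p i - q i\<bar>)" unfolding \<mu>_def using b by (intro sum_mono energy_le)
    also have "\<dots> \<le> real m * \<epsilon>\<^sub>1" using close by (simp add: mult_left_mono flip: sum_distrib_left)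
    finally have \<mu>: "\<mu> \<le> S / 4" using S3 by (simp add: S_def)
    have "?E (\<lambda>e'. ?E (\<lambda>e. 1 - of_bool (stat D m e e' \<le> S / 2))) \<le> V / (S / 2 - \<mu>)\<^sup>2"
      using \<mu> S by (intro chebyshev_expect2[OF w mean second]) (auto split: if_splits)
    also have "\<dots> \<le> (1/5 * (S / 4)\<^sup>2) / (S / 4)\<^sup>2"
    proof (rule frac_le)
      have "46080 * S \<le> S * S" using S by (intro mult_right_mono) auto
      then show "V \<le> 1/5 * (S / 4)\<^sup>2" using V \<mu> by (simp add: power2_eq_square)
      show "(S / 4)\<^sup>2 \<le> (S / 2 - \<mu>)\<^sup>2" using \<mu> S by (intro power_mono) auto
    qed (use S in auto)
    also have "\<dots> = 1/5" using S by simp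
    finally show ?thesis by (simp add: A_def S_def expect_diff expect_const[OF w])
  qed
  show "A \<le> 1/5" if far: "\<epsilon>\<^sub>2 \<le> (\<Sum>i\<in>D. \<bar>p i - q i\<bar>)"
  proof -
    have \<mu>: "S \<le> \<mu>" unfolding S_def \<mu>_def by (rule signal_le_sum_energy[OF pq card n \<epsilon> far])
    have "A \<le> V / (S / 2 - \<mu>)\<^sup>2"
      unfolding A_def S_def[symmetric]
      using \<mu> S by (intro chebyshev_expect2[OF w mean second]) (auto split: if_splits)
    also have "\<dots> \<le> (1/5 * (\<mu> / 2)\<^sup>2) / (\<mu> / 2)\<^sup>2"
    proof (rule frac_le)
      have "46080 * \<mu> \<le> \<mu> * \<mu>" using S \<mu> by (intro mult_right_mono) auto
      moreover have "S\<^sup>2 \<le> \<mu>\<^sup>2" using S \<mu> by (intro power_mono) auto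
      ultimately show "V \<le> 1/5 * (\<mu> / 2)\<^sup>2"
        using V zero_le_square[of \<mu>] by (simp add: power2_eq_square del: zero_le_square)
      have "(\<mu> / 2)\<^sup>2 \<le> (\<mu> - S / 2)\<^sup>2" using \<mu> S by (intro power_mono) auto
      then show "(\<mu> / 2)\<^sup>2 \<le> (S / 2 - \<mu>)\<^sup>2" by (simp add: power2_commute)
    qed (use S \<mu> in auto)
    also have "\<dots> = 1/5" using S \<mu> by simp
    finally show ?thesis .
  qed
qed

text \<open>Each of the three terms of the denominator gets a third of the budget:
  \<open>96 = 3 * 32\<close>.\<close>

lemma signal_ge:
  assumes n: "1 \<le> n" and \<epsilon>: "0 < \<epsilon>"
    and "96 * (y * real n) \<le> (real m * \<epsilon>)\<^sup>2"
    and "96 * (y * (real m * \<epsilon>)) \<le> (real m * \<epsilon>)\<^sup>2"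
    and "96 * (y * (sqrt (real m) * sqrt (real n))) \<le> (real m * \<epsilon>)\<^sup>2"
  shows "y \<le> signal n m \<epsilon>"
proof -
  have "0 < 32 * (real n + real m * \<epsilon> + sqrt (real m * real n))"
    using n \<epsilon> by (simp add: add_pos_nonneg)
  moreover have "y * (32 * (real n + real m * \<epsilon> + sqrt (real m * real n))) \<le> (real m * \<epsilon>)\<^sup>2"
    using assms(3-5) by (simp add: real_sqrt_mult algebra_simps)
  ultimately show ?thesis by (simp add: signal_def pos_le_divide_eq)
qed

text \<open>With \<open>M\<close> and \<open>N\<close> the roots of \<open>m\<close> and
  \<open>n\<close>, all estimates become polynomial. Each claim is tested by \<open>main\<close>
  against the three terms of the denominator.\<close>

lemma signal_large:
  fixes n m :: nat and \<epsilon>\<^sub>1 \<epsilon>\<^sub>2 :: real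
  assumes n: "1 \<le> n" and e2: "0 < \<epsilon>\<^sub>2" "\<epsilon>\<^sub>2 \<le> 1" and e1: "0 \<le> \<epsilon>\<^sub>1" "\<epsilon>\<^sub>1 \<le> 1/1000 * \<epsilon>\<^sub>2"
    and m: "10^8 * (real n * (\<epsilon>\<^sub>1 / \<epsilon>\<^sub>2\<^sup>2)\<^sup>2 + real n * (\<epsilon>\<^sub>1 / \<epsilon>\<^sub>2\<^sup>2) + sqrt (real n) / \<epsilon>\<^sub>2\<^sup>2) \<le> real m"
  shows "46080 \<le> signal n m \<epsilon>\<^sub>2"
    and "2880 * (real m * min 1 (real m / real n)) \<le> (signal n m \<epsilon>\<^sub>2)\<^sup>2"
    and "4 * (real m * \<epsilon>\<^sub>1) \<le> signal n m \<epsilon>\<^sub>2"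
proof -
  define M N e where "M = sqrt (real m)" and "N = sqrt (real n)" and "e = \<epsilon>\<^sub>2"
  have MN: "real m = M\<^sup>2" "real n = N\<^sup>2" by (simp_all add: M_def N_def)
  have N: "1 \<le> N" using n by (simp add: N_def)
  have e: "0 < e" "e \<le> 1" using e2 by (auto simp: e_def)
  have nonneg: "0 \<le> N\<^sup>2 * (\<epsilon>\<^sub>1 / e\<^sup>2)\<^sup>2" "0 \<le> N\<^sup>2 * (\<epsilon>\<^sub>1 / e\<^sup>2)" "0 \<le> N / e\<^sup>2"
    using e1 N e by auto
  have m0: "10^8 * (N\<^sup>2 * (\<epsilon>\<^sub>1 / e\<^sup>2)\<^sup>2 + N\<^sup>2 * (\<epsilon>\<^sub>1 / e\<^sup>2) + N / e\<^sup>2) \<le> M\<^sup>2"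
    using m unfolding MN(1,2)[symmetric] by (simp only: N_def e_def)
  have part: "10^8 * a \<le> x \<and> 10^8 * b \<le> x \<and> 10^8 * c \<le> x"
    if "10^8 * (a + b + c) \<le> x" "0 \<le> a" "0 \<le> b" "0 \<le> c" for a b c x :: real
    using that by simp
  have m': "10^8 * (N\<^sup>2 * (\<epsilon>\<^sub>1 / e\<^sup>2)\<^sup>2) \<le> M\<^sup>2" "10^8 * (N\<^sup>2 * (\<epsilon>\<^sub>1 / e\<^sup>2)) \<le> M\<^sup>2"
    "10^8 * (N / e\<^sup>2) \<le> M\<^sup>2"
    using part[OF m0 nonneg] by simp_all
  have M0: "0 \<le> M" by (simp add: M_def)
  have e2pos: "0 < e\<^sup>2" using e by simp
  have F1: "10^8 * N \<le> M\<^sup>2 * e\<^sup>2" using m'(3) e2pos by (simp add: field_simps)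
  have F2: "10^8 * (N\<^sup>2 * \<epsilon>\<^sub>1) \<le> M\<^sup>2 * e\<^sup>2" using m'(2) e2pos by (simp add: field_simps)
  \<comment> \<open>The root of the quadratic sample bound; it controls the close mean against the
    \<open>M * N\<close> term, as \<open>F2\<close> does against \<open>N\<^sup>2\<close> and the
    ratio bound in \<open>e1\<close> against \<open>M\<^sup>2 * e\<close>.\<close>
  have F3: "10^4 * (N * \<epsilon>\<^sub>1) \<le> M * e\<^sup>2"
  proof (rule power2_le_imp_le)
    have "10^8 * (N\<^sup>2 * \<epsilon>\<^sub>1\<^sup>2) \<le> M\<^sup>2 * (e\<^sup>2)\<^sup>2"
      using m'(1) e2pos by (simp add: power_divide field_simps)
    then show "(10^4 * (N * \<epsilon>\<^sub>1))\<^sup>2 \<le> (M * e\<^sup>2)\<^sup>2" by (simp add: power_mult_distrib)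
  qed (use M0 in auto)
  have "M\<^sup>2 * e\<^sup>2 \<le> M\<^sup>2 * e" using e by (intro mult_left_mono) (auto simp: power2_eq_square mult_left_le)
  then have F4: "10^8 * N \<le> M\<^sup>2 * e" using F1 by simp
  have F5: "10^4 \<le> M * e"
  proof (rule power2_le_imp_le)
    show "(10^4)\<^sup>2 \<le> (M * e)\<^sup>2" using F1 N by (simp add: power_mult_distrib)
  qed (use M0 e in auto)
  have "M * e \<le> M" using M0 e by (simp add: mult_left_le)
  then have M1: "1 \<le> M" using F5 by simp
  have sq: "(real m * e)\<^sup>2 = M\<^sup>2 * (M\<^sup>2 * e\<^sup>2)" "(real m * e)\<^sup>2 = (M\<^sup>2 * e) * (M\<^sup>2 * e)"
    by (simp_all add: MN power2_eq_square)
  have main: "y \<le> signal n m \<epsilon>\<^sub>2" if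
    "96 * (y * N\<^sup>2) \<le> (real m * e)\<^sup>2" "96 * (y * (M\<^sup>2 * e)) \<le> (real m * e)\<^sup>2"
    "96 * (y * (M * N)) \<le> (real m * e)\<^sup>2" for y
    using that signal_ge[OF n e2(1), of y m]
    by (simp only: MN[symmetric] M_def[symmetric] N_def[symmetric] e_def[symmetric])
  have MNF: "10^8 * (M\<^sup>2 * N) \<le> (real m * e)\<^sup>2"
    using mult_left_mono[OF F1, of "M\<^sup>2"] unfolding sq(1) by (simp add: mult_ac)
  have weaken: "96 * (46080 * x) \<le> y" if "10^8 * x \<le> y" "0 \<le> x" for x y :: real
    using that by simp
  show "46080 \<le> signal n m \<epsilon>\<^sub>2"
  proof (rule main)
    have "(10^8 * N) * (10^8 * N) \<le> (M\<^sup>2 * e) * (M\<^sup>2 * e)"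
      using N e by (intro mult_mono[OF F4 F4]) auto
    moreover have "0 \<le> N * N" by simp
    ultimately show "96 * (46080 * N\<^sup>2) \<le> (real m * e)\<^sup>2"
      unfolding sq(2) by (simp add: power2_eq_square del: zero_le_square)
    have "10^8 * (M\<^sup>2 * e) \<le> (M\<^sup>2 * e) * (M\<^sup>2 * e)"
      using F4 N e by (intro mult_right_mono) auto
    moreover have "0 \<le> M\<^sup>2 * e" using e by simp
    ultimately show "96 * (46080 * (M\<^sup>2 * e)) \<le> (real m * e)\<^sup>2" unfolding sq(2) by (rule weaken)
    have "M * N \<le> M\<^sup>2 * N" using M1 N by (intro mult_right_mono) (auto simp: power2_eq_square)
    moreover have "0 \<le> M\<^sup>2 * N" using N by simp
    ultimately show "96 * (46080 * (M * N)) \<le> (real m * e)\<^sup>2" using MNF by simp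
  qed
  show "2880 * (real m * min 1 (real m / real n)) \<le> (signal n m \<epsilon>\<^sub>2)\<^sup>2"
  proof -
    \<comment> \<open>The square of \<open>g\<close> is the noise term, and
      \<open>54 * 54 = 2916\<close> exceeds \<open>2880\<close>. Either argument of the minimum may
      be used as a bound.\<close>
    define g where "g = min M (M\<^sup>2 / N)"
    have g0: "0 \<le> g" using M0 N by (simp add: g_def)
    have "real m * min 1 (real m / real n) = g\<^sup>2"
    proof -
      have "M \<le> M\<^sup>2 / N \<longleftrightarrow> N \<le> M"
        using M1 N by (simp add: pos_le_divide_eq power2_eq_square)
      moreover have "1 \<le> real m / real n \<longleftrightarrow> N \<le> M"
        using n M0 N by (simp add: pos_le_divide_eq M_def N_def)
      ultimately show ?thesis
        by (auto simp: g_def min_def MN power_divide power2_eq_square)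
    qed
    moreover have "54 * g \<le> signal n m \<epsilon>\<^sub>2"
    proof (rule main)
      have gM: "g \<le> M" and gN: "g * N \<le> M\<^sup>2"
      proof -
        have "g \<le> M\<^sup>2 / N" by (simp add: g_def)
        then show "g * N \<le> M\<^sup>2" using N by (simp add: pos_le_divide_eq)
      qed (simp add: g_def)
      have P: "0 \<le> M\<^sup>2 * N" using N by simp
      have "(g * N) * N \<le> M\<^sup>2 * N" using gN N by (intro mult_right_mono) auto
      then show "96 * (54 * g * N\<^sup>2) \<le> (real m * e)\<^sup>2"
        using MNF P by (simp add: power2_eq_square mult_ac)
      have "10^4 * g \<le> (M * e) * M" using F5 gM g0 e M0 by (intro mult_mono) auto
      then have "10^4 * g * (M\<^sup>2 * e) \<le> (M\<^sup>2 * e) * (M\<^sup>2 * e)"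
        using e M0 by (intro mult_right_mono) (auto simp: power2_eq_square mult_ac)
      moreover have "0 \<le> g * (M\<^sup>2 * e)" using g0 e by simp
      ultimately show "96 * (54 * g * (M\<^sup>2 * e)) \<le> (real m * e)\<^sup>2"
        unfolding sq(2) by simp
      have "g * (M * N) \<le> M * (M * N)" using gM M0 N by (intro mult_right_mono) auto
      then show "96 * (54 * g * (M * N)) \<le> (real m * e)\<^sup>2"
        using MNF P by (simp add: power2_eq_square mult_ac)
    qed
    then have "(54 * g)\<^sup>2 \<le> (signal n m \<epsilon>\<^sub>2)\<^sup>2" using g0 by (intro power_mono) auto
    moreover have "2880 * g\<^sup>2 \<le> (54 * g)\<^sup>2" by (simp add: power_mult_distrib)
    ultimately show ?thesis by (metis order_trans)
  qed
  show "4 * (real m * \<epsilon>\<^sub>1) \<le> signal n m \<epsilon>\<^sub>2"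
  proof (rule main)
    have "M\<^sup>2 * (10^8 * (N\<^sup>2 * \<epsilon>\<^sub>1)) \<le> (real m * e)\<^sup>2"
      unfolding sq(1) using F2 by (intro mult_left_mono) auto
    moreover have "0 \<le> M\<^sup>2 * (N\<^sup>2 * \<epsilon>\<^sub>1)" using e1 by simp
    ultimately show "96 * (4 * (real m * \<epsilon>\<^sub>1) * N\<^sup>2) \<le> (real m * e)\<^sup>2" by (simp add: MN mult_ac)
    have "M\<^sup>2 * (1000 * \<epsilon>\<^sub>1) * (M\<^sup>2 * e) \<le> (M\<^sup>2 * e) * (M\<^sup>2 * e)"
      using e1 e by (intro mult_right_mono mult_left_mono) (auto simp: e_def)
    moreover have "0 \<le> (M\<^sup>2 * \<epsilon>\<^sub>1) * (M\<^sup>2 * e)" using e1 e by simp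
    ultimately show "96 * (4 * (real m * \<epsilon>\<^sub>1) * (M\<^sup>2 * e)) \<le> (real m * e)\<^sup>2"
      unfolding sq(2) by (simp add: MN mult_ac)
    have "M\<^sup>2 * M * (10^4 * (N * \<epsilon>\<^sub>1)) \<le> M\<^sup>2 * M * (M * e\<^sup>2)"
      using F3 M0 by (intro mult_left_mono) auto
    also have "\<dots> = (real m * e)\<^sup>2" unfolding sq(1) by (simp add: power2_eq_square)
    finally have "10^4 * (M\<^sup>2 * \<epsilon>\<^sub>1 * (M * N)) \<le> (real m * e)\<^sup>2" by (simp add: mult_ac)
    moreover have "0 \<le> M\<^sup>2 * \<epsilon>\<^sub>1 * (M * N)" using e1 M0 N by simp
    ultimately show "96 * (4 * (real m * \<epsilon>\<^sub>1) * (M * N)) \<le> (real m * e)\<^sup>2"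
      unfolding MN by simp
  qed
qed

section \<open>Flattening the reference distribution\<close>

text \<open>Element \<open>i\<close> is split into \<open>pieces n q i\<close> equally likely copies. This preserves \<open>\<ell>\<^sub>1\<close> distances,
  at most doubles the domain, and brings every reference probability below \<open>1/n\<close>.\<close>
definition pieces :: "nat \<Rightarrow> (nat \<Rightarrow> real) \<Rightarrow> nat \<Rightarrow> nat" where
  "pieces n q i = nat \<lfloor>real n * q i\<rfloor> + 1"

definition piece_set :: "nat \<Rightarrow> (nat \<Rightarrow> real) \<Rightarrow> (nat \<times> nat) set" where
  "piece_set n q = Sigma {1..n} (\<lambda>i. {..<pieces n q i})"

definition piece_kernel :: "nat \<Rightarrow> (nat \<Rightarrow> real) \<Rightarrow> nat \<Rightarrow> nat \<times> nat \<Rightarrow> real" where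
  "piece_kernel n q x d = (if fst d = x then 1 / real (pieces n q x) else 0)"

definition flatten :: "nat \<Rightarrow> (nat \<Rightarrow> real) \<Rightarrow> (nat \<Rightarrow> real) \<Rightarrow> nat \<times> nat \<Rightarrow> real" where
  "flatten n q p d = (\<Sum>x=1..n. p x * piece_kernel n q x d)"

lemma sum_piece_set:
  "(\<Sum>d\<in>piece_set n q. g (fst d)) = (\<Sum>i=1..n. real (pieces n q i) * g i)"
proof -
  have "(\<Sum>d\<in>piece_set n q. g (fst d)) = (\<Sum>i=1..n. \<Sum>j<pieces n q i. g i)"
    unfolding piece_set_def by (subst sum.Sigma) (auto simp: case_prod_beta)
  then show ?thesis by simp
qed

lemma pieces_pos: "0 < real (pieces n q i)"
  by (simp add: pieces_def)

lemma pieces_mult_divide: "real (pieces n q i) * (x / real (pieces n q i)) = x"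
  using pieces_pos[of n q i] by simp

lemma flatten_eq: "d \<in> piece_set n q \<Longrightarrow> flatten n q p d = p (fst d) / real (pieces n q (fst d))"
  by (auto simp: flatten_def piece_kernel_def piece_set_def if_distrib[of "\<lambda>c. _ * c"] cong: if_cong)

lemma prob_vec_piece_kernel:
  assumes "x \<in> {1..n}"
  shows "prob_vec (piece_set n q) (piece_kernel n q x)"
proof -
  have "(\<Sum>d\<in>piece_set n q. piece_kernel n q x d)
      = (\<Sum>i=1..n. real (pieces n q i) * (if i = x then 1 / real (pieces n q x) else 0))"
    unfolding piece_kernel_def by (rule sum_piece_set)
  also have "\<dots> = 1"
    using assms pieces_pos[of n q x] by (simp add: if_distrib[of "\<lambda>c. _ * c"] cong: if_cong)
  finally show ?thesis by (simp add: prob_vec_def piece_kernel_def)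
qed

lemma prob_vec_flatten:
  assumes "is_dist n p"
  shows "prob_vec (piece_set n q) (flatten n q p)"
proof -
  have "(\<Sum>d\<in>piece_set n q. flatten n q p d) = (\<Sum>d\<in>piece_set n q. p (fst d) / real (pieces n q (fst d)))"
    by (intro sum.cong refl flatten_eq)
  also have "\<dots> = (\<Sum>i=1..n. real (pieces n q i) * (p i / real (pieces n q i)))"
    by (rule sum_piece_set)
  also have "\<dots> = 1" unfolding pieces_mult_divide using assms by (simp add: is_dist_def)
  finally show ?thesis
    using assms by (auto simp: prob_vec_def is_dist_def flatten_eq piece_set_def)
qed

lemma l1_flatten: "(\<Sum>d\<in>piece_set n q. \<bar>flatten n q p d - flatten n q r d\<bar>) = l1_dist n p r"
proof -
  have "(\<Sum>d\<in>piece_set n q. \<bar>flatten n q p d - flatten n q r d\<bar>)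
      = (\<Sum>d\<in>piece_set n q. \<bar>p (fst d) - r (fst d)\<bar> / real (pieces n q (fst d)))"
    by (intro sum.cong refl) (simp add: flatten_eq flip: diff_divide_distrib)
  also have "\<dots> = (\<Sum>i=1..n. real (pieces n q i) * (\<bar>p i - r i\<bar> / real (pieces n q i)))"
    by (rule sum_piece_set)
  also have "\<dots> = l1_dist n p r" unfolding pieces_mult_divide by (simp add: l1_dist_def)
  finally show ?thesis .
qed

text \<open>The floors sum to at most \<open>n\<close> because \<open>q\<close> sums to one; the
  added ones contribute another \<open>n\<close>.\<close>

lemma card_piece_set:
  assumes "is_dist n q"
  shows "card (piece_set n q) \<le> 2 * n"
proof -
  have "real (card (piece_set n q)) = (\<Sum>i=1..n. real (pieces n q i))"
    using sum_piece_set[where g="\<lambda>_. 1"] by simp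
  also have "\<dots> \<le> (\<Sum>i=1..n. real n * q i + 1)"
  proof (rule sum_mono)
    fix i assume "i \<in> {1..n}"
    then have "0 \<le> real n * q i" using assms by (auto simp: is_dist_def)
    then show "real (pieces n q i) \<le> real n * q i + 1" by (simp add: pieces_def)
  qed
  also have "\<dots> = 2 * real n" using assms by (simp add: sum.distrib is_dist_def flip: sum_distrib_left)
  finally show ?thesis by simp
qed

lemma flatten_self_le:
  assumes "is_dist n q" "1 \<le> n" "d \<in> piece_set n q"
  shows "flatten n q q d \<le> 1 / real n"
proof -
  have "0 \<le> q (fst d)" using assms by (auto simp: is_dist_def piece_set_def)
  then have "real n * q (fst d) \<le> real (pieces n q (fst d))" unfolding pieces_def by linarith
  then show ?thesis
    using pieces_pos[of n q "fst d"] assms by (simp add: flatten_eq field_simps)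
qed

section \<open>The tester and its acceptance probability\<close>

text \<open>The tester's own randomness, namely the random copies and the simulated samples, is
  averaged out by \<open>expect\<close>. Lists leaving \<open>{1..n}\<close>, where
  \<open>piece_kernel\<close> is no probability vector, get the default \<open>0\<close>, as
  acceptance values are required on every list.\<close>

definition tester :: "nat \<Rightarrow> (nat \<Rightarrow> real) \<Rightarrow> nat \<Rightarrow> real \<Rightarrow> nat list \<Rightarrow> real" where
  "tester n q m \<tau> xs = (if set xs \<subseteq> {1..n} then
     (let X = piece_set n q \<times> UNIV; K = (\<lambda>x. tag True (piece_kernel n q x));
          Qs = replicate m (tag False (flatten n q q))
      in expect X (map K (take m xs) @ Qs) (\<lambda>e'. expect X (map K (drop m xs) @ Qs)
           (\<lambda>e. of_bool (stat (piece_set n q) m e e' \<le> \<tau>)))) else 0)"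

lemma tester_bounds:
  assumes "is_dist n q"
  shows "0 \<le> tester n q m \<tau> xs \<and> tester n q m \<tau> xs \<le> 1"
proof (cases "set xs \<subseteq> {1..n}")
  case True
  let ?X = "piece_set n q \<times> UNIV" and ?K = "\<lambda>x. tag True (piece_kernel n q x)"
  let ?Qs = "replicate m (tag False (flatten n q q))"
  let ?f = "\<lambda>e' e. of_bool (stat (piece_set n q) m e e' \<le> \<tau>)"
  have w: "\<forall>w\<in>set (map ?K ys @ ?Qs). prob_vec ?X w" if "set ys \<subseteq> {1..n}" for ys
    using that assms by (auto intro!: prob_vec_tag prob_vec_piece_kernel prob_vec_flatten)
  have w1: "\<forall>w\<in>set (map ?K (take m xs) @ ?Qs). prob_vec ?X w"
    and w2: "\<forall>w\<in>set (map ?K (drop m xs) @ ?Qs). prob_vec ?X w"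
    by (rule w, rule order_trans[OF set_take_subset True],
        rule w, rule order_trans[OF set_drop_subset True])
  let ?E = "\<lambda>f. expect ?X (map ?K (take m xs) @ ?Qs) (\<lambda>e'. expect ?X (map ?K (drop m xs) @ ?Qs) (\<lambda>e. f e' e))"
  have "?E (\<lambda>_ _. 0) \<le> ?E ?f" "?E ?f \<le> ?E (\<lambda>_ _. 1)"
    by (intro expect_mono[OF w1] expect_mono[OF w2]; simp)+
  then show ?thesis
    using True by (simp add: tester_def Let_def expect_const[OF w1] expect_const[OF w2])
qed (simp add: tester_def)

text \<open>The samples split into two independent batches, and \<open>expect_channel\<close> turns
  each into a pool over the flattened domain.\<close>

lemma accept_prob_tester:
  fixes \<tau> :: real
  defines "X \<equiv> \<lambda>n q. piece_set n q \<times> (UNIV :: bool set)"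
  shows "accept_prob n (m + m) (tester n q m \<tau>) p
    = expect (X n q) (tagged m (flatten n q p) (flatten n q q))
        (\<lambda>e'. expect (X n q) (tagged m (flatten n q p) (flatten n q q))
          (\<lambda>e. of_bool (stat (piece_set n q) m e e' \<le> \<tau>)))"
proof -
  let ?X = "X n q" and ?K = "\<lambda>x. tag True (piece_kernel n q x)"
  let ?Qs = "replicate m (tag False (flatten n q q))"
  let ?f = "\<lambda>e' e. of_bool (stat (piece_set n q) m e e' \<le> \<tau>)"
  let ?P = "expect {1..n} (replicate m p)"
  have "(\<lambda>y. \<Sum>x=1..n. p x * ?K x y) = tag True (flatten n q p)"
    by (auto simp: fun_eq_iff tag_def flatten_def)
  then have chan: "?P (\<lambda>xs. expect ?X (map ?K xs @ ?Qs) g)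
      = expect ?X (tagged m (flatten n q p) (flatten n q q)) g" for g
    by (simp add: expect_channel tagged_def)
  have "accept_prob n (m + m) (tester n q m \<tau>) p
      = ?P (\<lambda>xs. ?P (\<lambda>ys. tester n q m \<tau> (xs @ ys)))"
    by (simp add: accept_prob_eq_expect replicate_add expect_append)
  also have "\<dots> = ?P (\<lambda>xs. ?P (\<lambda>ys. expect ?X (map ?K xs @ ?Qs)
      (\<lambda>e'. expect ?X (map ?K ys @ ?Qs) (?f e'))))"
    by (intro expect_cong) (simp add: tester_def Let_def X_def)
  \<comment> \<open>The second batch is averaged inside the first pool, so that \<open>chan\<close>
    applies to each pool separately.\<close>
  also have "\<dots> = ?P (\<lambda>xs. expect ?X (map ?K xs @ ?Qs)
      (\<lambda>e'. ?P (\<lambda>ys. expect ?X (map ?K ys @ ?Qs) (?f e'))))"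
    by (subst expect_swap) (rule refl)
  finally show ?thesis by (simp only: chan)
qed

theorem theorem2p1:
  shows "\<exists>c::real>0. \<exists>C::real>0. \<forall>n::nat. \<forall>q::nat \<Rightarrow> real. \<forall>\<epsilon>\<^sub>1 \<epsilon>\<^sub>2::real.
    1 \<le> n \<and> is_dist n q \<and> 0 < \<epsilon>\<^sub>2 \<and> \<epsilon>\<^sub>2 \<le> 1 \<and> 0 \<le> \<epsilon>\<^sub>1 \<and> \<epsilon>\<^sub>1 \<le> c * \<epsilon>\<^sub>2 \<longrightarrow>
    (\<exists>m::nat. real m \<le> C * (real n * (\<epsilon>\<^sub>1 / \<epsilon>\<^sub>2\<^sup>2)\<^sup>2 + real n * (\<epsilon>\<^sub>1 / \<epsilon>\<^sub>2\<^sup>2)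
                               + sqrt (real n) / \<epsilon>\<^sub>2\<^sup>2) \<and>
      (\<exists>T::nat list \<Rightarrow> real. (\<forall>xs. 0 \<le> T xs \<and> T xs \<le> 1) \<and>
         (\<forall>p. is_dist n p \<longrightarrow>
            (l1_dist n p q \<le> \<epsilon>\<^sub>1 \<longrightarrow> accept_prob n m T p \<ge> 4/5) \<and>
            (l1_dist n p q \<ge> \<epsilon>\<^sub>2 \<longrightarrow> 1 - accept_prob n m T p \<ge> 4/5))))"
proof -
  have key: "\<exists>m. real m \<le> 2 * (10^8 + 1) * (real n * (\<epsilon>\<^sub>1 / \<epsilon>\<^sub>2\<^sup>2)\<^sup>2 + real n * (\<epsilon>\<^sub>1 / \<epsilon>\<^sub>2\<^sup>2)
                               + sqrt (real n) / \<epsilon>\<^sub>2\<^sup>2) \<and>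
      (\<exists>T::nat list \<Rightarrow> real. (\<forall>xs. 0 \<le> T xs \<and> T xs \<le> 1) \<and>
         (\<forall>p. is_dist n p \<longrightarrow>
            (l1_dist n p q \<le> \<epsilon>\<^sub>1 \<longrightarrow> accept_prob n m T p \<ge> 4/5) \<and>
            (l1_dist n p q \<ge> \<epsilon>\<^sub>2 \<longrightarrow> 1 - accept_prob n m T p \<ge> 4/5)))"
    if n: "1 \<le> n" and q: "is_dist n q" and e2: "0 < \<epsilon>\<^sub>2" "\<epsilon>\<^sub>2 \<le> 1"
      and e1: "0 \<le> \<epsilon>\<^sub>1" "\<epsilon>\<^sub>1 \<le> 1/1000 * \<epsilon>\<^sub>2" for n q \<epsilon>\<^sub>1 \<epsilon>\<^sub>2
  proof -
    define B where "B = real n * (\<epsilon>\<^sub>1 / \<epsilon>\<^sub>2\<^sup>2)\<^sup>2 + real n * (\<epsilon>\<^sub>1 / \<epsilon>\<^sub>2\<^sup>2) + sqrt (real n) / \<epsilon>\<^sub>2\<^sup>2"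
    define m where "m = nat \<lceil>10^8 * B\<rceil>"
    \<comment> \<open>This makes \<open>B\<close> at least \<open>1\<close>, so rounding up costs at
      most one more \<open>B\<close>; two batches then give the constant
      \<open>2 * (10^8 + 1)\<close>.\<close>
    have "1 \<le> sqrt (real n) / \<epsilon>\<^sub>2\<^sup>2"
    proof -
      have "\<epsilon>\<^sub>2\<^sup>2 \<le> 1" using e2 by (simp add: power_le_one)
      moreover have "1 \<le> sqrt (real n)" using n by simp
      ultimately have "\<epsilon>\<^sub>2\<^sup>2 \<le> sqrt (real n)" by linarith
      then show ?thesis using e2 by (simp add: pos_le_divide_eq)
    qed
    moreover have "0 \<le> real n * (\<epsilon>\<^sub>1 / \<epsilon>\<^sub>2\<^sup>2)\<^sup>2" "0 \<le> real n * (\<epsilon>\<^sub>1 / \<epsilon>\<^sub>2\<^sup>2)" using e1 by auto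
    ultimately have B: "1 \<le> B" unfolding B_def by linarith
    have m: "10^8 * B \<le> real m" "real m \<le> 10^8 * B + 1"
      using B of_int_ceiling_le_add_one[of "10^8 * B"] le_of_int_ceiling[of "10^8 * B"]
      by (simp_all add: m_def)
    note large = signal_large[OF n e2 e1 m(1)[unfolded B_def]]
    have "real (m + m) \<le> 2 * (10^8 + 1) * B" using m(2) B by simp
    moreover have "(l1_dist n p q \<le> \<epsilon>\<^sub>1 \<longrightarrow>
          4/5 \<le> accept_prob n (m + m) (tester n q m (signal n m \<epsilon>\<^sub>2 / 2)) p) \<and>
        (\<epsilon>\<^sub>2 \<le> l1_dist n p q \<longrightarrow>
          4/5 \<le> 1 - accept_prob n (m + m) (tester n q m (signal n m \<epsilon>\<^sub>2 / 2)) p)"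
      if p: "is_dist n p" for p
      using signal_test[OF prob_vec_flatten[OF p] prob_vec_flatten[OF q] card_piece_set[OF q] n e2(1)
          flatten_self_le[OF q n] large]
      unfolding accept_prob_tester l1_flatten by auto
    ultimately show ?thesis
      unfolding B_def[symmetric] using tester_bounds[OF q, of m "signal n m \<epsilon>\<^sub>2 / 2"] by blast
  qed
  show ?thesis
    by (rule exI[of _ "1/1000"], rule conjI, simp, rule exI[of _ "2 * (10^8 + 1)"], rule conjI, simp,
        intro allI impI, elim conjE, rule key)
qed

end
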